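(* Let $M>0$, $L>0$, and let $\ell:[0,1]^2\to[0,1]$ be convex and $M$-Lipschitz in its first argument. Let $(t_d)_{d\ge1}$ be a (strictly) increasing sequence of integers with $t_1=2$, and let $D_s=\sup\{d\ge1: t_d\le s\}$. Let $(y_t)_{t=-\infty}^{+\infty}$ be any sequence in $[0,1]$. Let $\hat y_t$, $t\ge1$, be the predictions of the meta-algorithm run with starting times $(t_d)$, forecasters $(\mathcal{A}_d)_{d\ge1}$ and learning rates $\eta_t=2/\sqrt{t}$. Then for all $T\ge1$ and all $d\ge1$ with $d\le D_T$, \[ \hat R_{L,T}^d = \sum_{t=1}^T \ell(\hat y_t,y_t) - \inf_{f\in\mathcal{L}_L^d}\sum_{t=1}^T \ell\bigl(f(y_{t-d}^{t-1}),y_t\bigr) \leq t_d + \sqrt{T+1}\,\log D_{T+1} + M(3+L)\Bigl(\sqrt{T}+2(3d)^{\frac{d}{2(d+2)}}\,T^{\frac{d+1}{d+2}}\Bigr). \] Consequently, for all $d\ge1$, $\limsup_{T\to\infty}\bigl(\hat R_{L,T}^d/T\bigr)\le 0$.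
   Context: $\mathcal{L}_L^d$ is the set of functions $[0,1]^d\to[0,1]$ that are $L$-Lipschitz for the Euclidean norm, and $y_{t-d}^{t-1}=(y_{t-d},\dots,y_{t-1})$. For a set $A$, $\operatorname{diam}(A)=\sup_{\boldsymbol{x},\boldsymbol{x}'\in A}\|\boldsymbol{x}-\boldsymbol{x}'\|_2$. At time $t$ the forecaster must output $\hat y_t\in[0,1]$ knowing only $y_1,\dots,y_{t-1}$, and then observes $y_t$. EG forecaster (with parameter $M$): run on a sequence $y_1,y_2,\dots\in[0,1]$, it uses rates $M^{-1}\sqrt{(\log 2)/t}=:\tilde\eta_t$ and at step $t$ predicts \[\hat y_t=\frac{\exp(-\tilde\eta_t\sum_{s=1}^{t-1}\ell'(\hat y_s,y_s))}{1+\exp(-\tilde\eta_t\sum_{s=1}^{t-1}\ell'(\hat y_s,y_s))},\] where $\ell'$ is a (sub)gradient of $\ell$ with respect to its first argument; then it observes $y_t$. Regions: to each pair $(h,i)$ with $h\ge0$, $1\le i\le 2^h$, a hyper-rectangle $\mathcal{X}^{(h,i)}\subset[0,1]^d$ is attached recursively. $\mathcal{X}^{(0,1)}=[0,1]^d$. Given $\mathcal{X}^{(h,i)}$, write $h=kd+r$ with $r\in\{0,\dots,d-1\}$, let $x^-$ and $x^+$ be the infimum and supremum of the coordinate $x_{r+1}$ over $\mathcal{X}^{(h,i)}$, and $\tau=(x^-+x^+)/2$. Then $\mathcal{X}^{(h+1,2i-1)}=\{\boldsymbol{x}\in\mathcal{X}^{(h,i)}: x_{r+1}\in[x^-,\tau)\}$,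 and $\mathcal{X}^{(h+1,2i)}=\{\boldsymbol{x}\in\mathcal{X}^{(h,i)}: x_{r+1}\in[\tau,x^+)\}$ if $x^+<1$, respectively $\{\boldsymbol{x}\in\mathcal{X}^{(h,i)}: x_{r+1}\in[\tau,1]\}$ if $x^+=1$. Nested EG strategy in dimension $d$ (run on a sequence $(\boldsymbol{x}_t,y_t)\in[0,1]^d\times[0,1]$): it maintains a finite binary tree $\mathcal{T}$ of nodes $(h,i)$, where $(h+1,2i-1)$ and $(h+1,2i)$ are the children of $(h,i)$; initially $\mathcal{T}=\{(0,1)\}$. Each node $(h,i)$, when created, is given a fresh copy $\mathcal{E}^{(h,i)}$ of the EG forecaster. At each step $t$: observe $\boldsymbol{x}_t$; let $(h_t,i_t)$ be the leaf of $\mathcal{T}$ with $\boldsymbol{x}_t\in\mathcal{X}^{(h_t,i_t)}$; predict according to $\mathcal{E}^{(h_t,i_t)}$; observe $y_t$ and feed it to $\mathcal{E}^{(h_t,i_t)}$; set $T^{(h_t,i_t)}=\#\{s\le t:(h_s,i_s)=(h_t,i_t)\}$; if $T^{(h_t,i_t)}+1\ge \operatorname{diam}(\mathcal{X}^{(h_t,i_t)})^{-2}$, add the two children of $(h_t,i_t)$ to $\mathcal{T}$. Forecaster $\mathcal{A}_d$ (with starting time $t_d$): for $t\le t_d-1$ it forms no prediction and only observes $y_t$; for $t\ge t_d$ it sets $\boldsymbol{x}_t=y_{t-d}^{t-1}$, and its prediction $f_{d,t}$ is that of the nested EG strategy in dimension $d$ (with parameter $M$), started at time $t_d$ and run on $(\boldsymbol{x}_t,y_t)_{t\ge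 t_d}$. Meta-algorithm (parameters: starting times $(t_d)$, forecasters $(\mathcal{F}_d)_{d\ge1}$ where $\mathcal{F}_d$ forms predictions $f_{d,t}$ for $t\ge t_d$, learning rates $(\eta_t)$): for $t=1,\dots,t_1-1$ predict $\hat y_t=1/2$; set $\hat p_{1,t_1}=1$. For $t\ge t_1$: predict $\hat y_t=\sum_{d=1}^{D_t}\hat p_{d,t}f_{d,t}$; if $t_{D_t+1}=t+1$ then $D_{t+1}=D_t+1$ and the new forecaster receives weight $\hat p_{D_{t+1},t+1}=1/D_{t+1}$, otherwise $D_{t+1}=D_t$; observe $y_t$ and set, for $d=1,\dots,D_t$, \[\hat p_{d,t+1}=\frac{D_t}{D_{t+1}}\cdot\frac{\hat p_{d,t}^{\,\eta_{t+1}/\eta_t}e^{-\eta_{t+1}\ell(f_{d,t},y_t)}}{\sum_{k=1}^{D_t}\hat p_{k,t}^{\,\eta_{t+1}/\eta_t}e^{-\eta_{t+1}\ell(f_{k,t},y_t)}}.\] *)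

theory Defs
  imports "HOL-Analysis.Analysis"
begin

section \<open>Points of the unit cube and Lipschitz functions\<close>

text \<open>
  The dimension varies inside the statement, so a point of $[0,1]^d$ is a function
  on the index set \<open>{1..d}\<close> (extended by \<^term>\<open>undefined\<close> elsewhere), and the Euclidean
  distance is computed over these indices.
\<close>

definition unit_cube :: "nat \<Rightarrow> (nat \<Rightarrow> real) set" where
  "unit_cube d = {1..d} \<rightarrow>\<^sub>E {0..1}"

definition eucl_dist :: "nat \<Rightarrow> (nat \<Rightarrow> real) \<Rightarrow> (nat \<Rightarrow> real) \<Rightarrow> real" where
  "eucl_dist d x x' = L2_set (\<lambda>j. x j - x' j) {1..d}"

definition eucl_diam :: "nat \<Rightarrow> (nat \<Rightarrow> real) set \<Rightarrow> real" where
  "eucl_diam d A = (SUP (x, x') \<in> A \<times> A. eucl_dist d x x')"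

definition lipschitz_class :: "real \<Rightarrow> nat \<Rightarrow> ((nat \<Rightarrow> real) \<Rightarrow> real) set" where
  "lipschitz_class L d =
     {f \<in> unit_cube d \<rightarrow>\<^sub>E {0..1}.
        \<forall>x\<in>unit_cube d. \<forall>x'\<in>unit_cube d. \<bar>f x - f x'\<bar> \<le> L * eucl_dist d x x'}"

text \<open>The vector $(y_{t-d}, \dots, y_{t-1})$.\<close>

definition window :: "(int \<Rightarrow> real) \<Rightarrow> nat \<Rightarrow> nat \<Rightarrow> (nat \<Rightarrow> real)" where
  "window y d t = (\<lambda>j\<in>{1..d}. y (int t - int d + int j - 1))"

definition subgradient_fst :: "(real \<Rightarrow> real \<Rightarrow> real) \<Rightarrow> (real \<Rightarrow> real \<Rightarrow> real) \<Rightarrow> bool" where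
  "subgradient_fst loss loss' \<longleftrightarrow>
     (\<forall>x\<in>{0..1}. \<forall>y\<in>{0..1}. \<forall>z\<in>{0..1}. loss z y \<ge> loss x y + loss' x y * (z - x))"


section \<open>The EG forecaster\<close>

text \<open>
  \<open>eg M loss' ys\<close> is the prediction made at step \<open>t = length ys + 1\<close> after observing the list
  \<open>ys\<close> = $[y_1,\dots,y_{t-1}]$ (oldest first). Entry \<open>ys ! s\<close> is the observation of step
  \<open>s + 1\<close>, and \<open>take s ys\<close> is what was known when predicting it.
\<close>

fun eg :: "real \<Rightarrow> (real \<Rightarrow> real \<Rightarrow> real) \<Rightarrow> real list \<Rightarrow> real" where
  "eg M loss' ys =
     (let rate = inverse M * sqrt (ln 2 / real (length ys + 1));
          w = exp (- rate * (\<Sum>s<length ys. loss' (eg M loss' (take s ys)) (ys ! s)))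
      in w / (1 + w))"

text \<open>The defining equation loops as a rewrite rule.\<close>

declare eg.simps [simp del]


section \<open>The nested EG strategy\<close>

text \<open>
  Nodes are pairs \<open>(h, i)\<close> with $1 \le i \le 2^h$. The parent of \<open>(Suc h, i)\<close> is
  \<open>(h, (i + 1) div 2)\<close>; odd \<open>i\<close> gives its first child and even \<open>i\<close> its second one.
\<close>

type_synonym node = "nat \<times> nat"

primrec region :: "nat \<Rightarrow> nat \<Rightarrow> nat \<Rightarrow> (nat \<Rightarrow> real) set" where
  "region d 0 i = unit_cube d"
| "region d (Suc h) i =
     (let X = region d h ((i + 1) div 2);
          c = h mod d + 1;
          lo = (INF x\<in>X. x c);
          hi = (SUP x\<in>X. x c);
          mid = (lo + hi) / 2
      in if odd i then {x \<in> X. x c \<in> {lo..<mid}}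
         else if hi < 1 then {x \<in> X. x c \<in> {mid..<hi}}
         else {x \<in> X. x c \<in> {mid..1}})"

definition children :: "node \<Rightarrow> node set" where
  "children v = (case v of (h, i) \<Rightarrow> {(h + 1, 2 * i - 1), (h + 1, 2 * i)})"

definition leaf_of :: "nat \<Rightarrow> node set \<Rightarrow> (nat \<Rightarrow> real) \<Rightarrow> node" where
  "leaf_of d \<T> x =
     (THE v. v \<in> \<T> \<and> children v \<inter> \<T> = {} \<and> x \<in> region d (fst v) (snd v))"

text \<open>
  A state consists of the current tree and, for each node, the list of the observations fed to
  its copy of EG so far (oldest first). The length of that list is the number of steps at which
  the node was the selected leaf.
\<close>

type_synonym nested_state = "node set \<times> (node \<Rightarrow> real list)"

definition nested_init :: nested_state where
  "nested_init = ({(0, 1)}, \<lambda>_. [])"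

definition nested_step :: "nat \<Rightarrow> (nat \<Rightarrow> real) \<times> real \<Rightarrow> nested_state \<Rightarrow> nested_state" where
  "nested_step d = (\<lambda>(x, y) (\<T>, obs).
     let v = leaf_of d \<T> x;
         obs' = obs(v := obs v @ [y]);
         n = length (obs' v)
     in (if real n + 1 \<ge> 1 / (eucl_diam d (region d (fst v) (snd v)))\<^sup>2
         then \<T> \<union> children v else \<T>,
         obs'))"

text \<open>
  Prediction of the nested EG strategy at the point \<open>x\<close>, after it was run on the list
  \<open>past\<close> of pairs (oldest first).
\<close>

definition nested_eg ::
  "real \<Rightarrow> (real \<Rightarrow> real \<Rightarrow> real) \<Rightarrow> nat \<Rightarrow> ((nat \<Rightarrow> real) \<times> real) list \<Rightarrow> (nat \<Rightarrow> real) \<Rightarrow> real"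
where
  "nested_eg M loss' d past x =
     (let (\<T>, obs) = fold (nested_step d) past nested_init
      in eg M loss' (obs (leaf_of d \<T> x)))"

text \<open>
  Prediction $f_{d,t}$ of the forecaster $\mathcal{A}_d$ with starting times \<open>\<tau>\<close>;
  meaningful for \<open>t \<ge> \<tau> d\<close> only.
\<close>

definition forecaster ::
  "real \<Rightarrow> (real \<Rightarrow> real \<Rightarrow> real) \<Rightarrow> (nat \<Rightarrow> nat) \<Rightarrow> (int \<Rightarrow> real) \<Rightarrow> nat \<Rightarrow> nat \<Rightarrow> real"
where
  "forecaster M loss' \<tau> y d t =
     nested_eg M loss' d (map (\<lambda>s. (window y d s, y (int s))) [\<tau> d..<t]) (window y d t)"


section \<open>The meta-algorithm\<close>

definition num_active :: "(nat \<Rightarrow> nat) \<Rightarrow> nat \<Rightarrow> nat" where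
  "num_active \<tau> s = Sup {d. 1 \<le> d \<and> \<tau> d \<le> s}"

text \<open>
  The number of active forecasters follows the recursion used by the meta-algorithm.
\<close>

lemma num_active_Suc:
  assumes mono: "strict_mono_on {1..} \<tau>" and start: "\<tau> 1 \<le> t"
  shows "num_active \<tau> (Suc t) =
           (if \<tau> (num_active \<tau> t + 1) = t + 1 then num_active \<tau> t + 1 else num_active \<tau> t)"
proof -
  let ?A = "\<lambda>s. {d. 1 \<le> d \<and> \<tau> d \<le> s}"
  have ge: "d \<le> \<tau> d + 1" if "1 \<le> d" for d
    using that
  proof (induction d rule: dec_induct)
    case (step n)
    have "\<tau> n < \<tau> (Suc n)"
      using mono step by (auto simp: strict_mono_on_def)
    with step show ?case by simp
  qed simp
  have fin: "finite (?A s)" for s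
    by (rule finite_subset[of _ "{..s + 1}"]) (use ge in fastforce)+
  have ne: "?A s \<noteq> {}" if "s \<ge> t" for s
    using start that by (auto intro: exI[of _ 1])
  have Max: "num_active \<tau> s = Max (?A s)" if "s \<ge> t" for s
    unfolding num_active_def Sup_nat_def using ne[OF that] by (rule if_not_P)
  let ?D = "num_active \<tau> t"
  have D: "?D \<in> ?A t"
    using Max[of t] Max_in[OF fin ne[of t]] by simp
  have next_gt: "\<tau> (?D + 1) > t"
  proof (rule ccontr)
    assume "\<not> \<tau> (?D + 1) > t"
    then have "?D + 1 \<in> ?A t" by simp
    then have "?D + 1 \<le> Max (?A t)" using fin by (rule Max_ge[rotated])
    with Max[of t] show False by simp
  qed
  have le: "d \<le> ?D" if "1 \<le> d" "\<tau> d < \<tau> (?D + 1)" for d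
    using that mono by (metis add.commute atLeast_iff le_add1 less_Suc_eq_le not_less
        plus_1_eq_Suc strict_mono_on_less)
  show ?thesis
  proof (cases "\<tau> (?D + 1) = t + 1")
    case True
    have "Max (?A (Suc t)) = ?D + 1"
    proof (rule Max_eqI[OF fin])
      fix d assume d: "d \<in> ?A (Suc t)"
      then have "\<tau> d \<le> \<tau> (?D + 1)" using True by simp
      with d mono show "d \<le> ?D + 1"
        by (metis (no_types, lifting) atLeast_iff le_add2 mem_Collect_eq not_less
            strict_mono_on_less)
    qed (use True in simp)
    with True Max[of "Suc t"] show ?thesis by simp
  next
    case False
    have "Max (?A (Suc t)) = ?D"
    proof (rule Max_eqI[OF fin])
      fix d assume "d \<in> ?A (Suc t)"
      with False next_gt show "d \<le> ?D" by (intro le) auto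
    qed (use D in simp)
    with False Max[of "Suc t"] show ?thesis by simp
  qed
qed

text \<open>
  \<open>meta_weight \<tau> \<eta> loss f y t d\<close> is the weight $\hat p_{d,t}$. It is relevant only for
  \<open>t \<ge> \<tau> 1\<close> and \<open>1 \<le> d \<le> num_active \<tau> t\<close>.
\<close>

primrec meta_weight ::
  "(nat \<Rightarrow> nat) \<Rightarrow> (nat \<Rightarrow> real) \<Rightarrow> (real \<Rightarrow> real \<Rightarrow> real) \<Rightarrow> (nat \<Rightarrow> nat \<Rightarrow> real) \<Rightarrow> (int \<Rightarrow> real)
     \<Rightarrow> nat \<Rightarrow> nat \<Rightarrow> real"
where
  "meta_weight \<tau> \<eta> loss f y 0 = (\<lambda>d. of_bool (d = 1))"
| "meta_weight \<tau> \<eta> loss f y (Suc t) = (\<lambda>d.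
     let p = meta_weight \<tau> \<eta> loss f y t;
         D = num_active \<tau> t;
         D' = num_active \<tau> (t + 1);
         u = (\<lambda>k. p k powr (\<eta> (t + 1) / \<eta> t) * exp (- \<eta> (t + 1) * loss (f k t) (y (int t))))
     in if t + 1 \<le> \<tau> 1 then of_bool (d = 1)
        else if d \<in> {1..D} then real D / real D' * (u d / (\<Sum>k=1..D. u k))
        else if d = D + 1 \<and> \<tau> (D + 1) = t + 1 then 1 / real D'
        else 0)"

definition meta_predict ::
  "(nat \<Rightarrow> nat) \<Rightarrow> (nat \<Rightarrow> real) \<Rightarrow> (real \<Rightarrow> real \<Rightarrow> real) \<Rightarrow> (nat \<Rightarrow> nat \<Rightarrow> real) \<Rightarrow> (int \<Rightarrow> real)
     \<Rightarrow> nat \<Rightarrow> real"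
where
  "meta_predict \<tau> \<eta> loss f y t =
     (if t < \<tau> 1 then 1 / 2
      else (\<Sum>d=1..num_active \<tau> t. meta_weight \<tau> \<eta> loss f y t d * f d t))"


section \<open>Regret\<close>

definition regret ::
  "(real \<Rightarrow> real \<Rightarrow> real) \<Rightarrow> (int \<Rightarrow> real) \<Rightarrow> (nat \<Rightarrow> real) \<Rightarrow> real \<Rightarrow> nat \<Rightarrow> nat \<Rightarrow> real"
where
  "regret loss y yhat L d T =
     (\<Sum>t=1..T. loss (yhat t) (y (int t)))
       - (INF f\<in>lipschitz_class L d. \<Sum>t=1..T. loss (f (window y d t)) (y (int t)))"

end

theory Submission
  imports Defs "HOL-Probability.Hoeffding" "HOL-Real_Asymp.Real_Asymp"
begin

text \<open>
  The regret against the Lipschitz functions of $d$ variables splits into three parts: the rounds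
  before \<open>\<tau> d\<close>, each of which costs at most 1; the regret of the meta-algorithm against the
  forecaster $\mathcal{A}_d$; and the regret of $\mathcal{A}_d$ against a Lipschitz function.

  The meta-algorithm and EG are the same object: exponential weights with a decreasing learning
  rate, updated by $p \mapsto p^{\eta'/\eta} e^{-\eta' \ell}$ and normalised. One round of such an
  update pays at most $\eta R^2/8$ (Hoeffding's lemma, losses of range $R$) plus the increment of
  the potential $\ln(K p_d)/\eta$, where $K$ is the number of experts (\<open>exp_weights_step\<close>). The
  number of experts inside the logarithm is what makes the argument work when experts arrive: a
  newcomer gets weight $1/K$, hence potential 0, and the factor $D_t/D_{t+1}$ on the older weights
  cancels in $K p_d$. So everything telescopes to $\ln D_{T+1}/\eta_{T+1}$ plus the sum of the
  Hoeffding terms (\<open>meta_regret\<close>). The range of a loss is at most $\min(1,M)$, whose square is at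
  most $M$, so these terms are proportional to $M$. EG is the case of the two constant experts 0
  and 1 with linearised losses, which gives regret at most $\frac32 M \sqrt n$ after $n$ rounds
  against every constant (\<open>eg_regret\<close>).

  For the nested strategy, a node which was selected $n$ times and whose region has diameter
  $\delta$ satisfies $n \le 1$ or $n \le \delta^{-2}$, for otherwise it would have been split
  earlier. On its rounds a Lipschitz function differs from a constant (half of the sum of its
  extreme values there) by at most $L/(2\sqrt n)$. Hence the node costs at most
  $\frac{M(3+L)}{2}\sqrt n$ (\<open>node_regret\<close>). By the Cauchy-Schwarz inequality the total cost is
  at most $\frac{M(3+L)}{2}\sqrt{N T}$ with $N$ the number of nodes.

  To bound $N$, note that an inner node at depth $h$ was selected at least $4^{h/d}/(8d)$ times,
  because regions at depth $h$ have squared diameter at most $4d\,4^{-h/d}$. The inner nodes above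
  a depth $H$ are at most $2^H$ and those below it at most $8dT/4^{H/d}$; balancing the two leads
  to $2^H \approx Q = (3dT)^{d/(d+2)}$ and $N \le 16 Q$ (\<open>card_nested_tree_le\<close>), so that
  $\frac12\sqrt{N T} \le 2\sqrt{Q T}$ is exactly the term of the theorem.

  All terms of the bound are $o(T)$, as $D_{T+1} \le T+1$ and $(d+1)/(d+2) < 1$; this yields the
  asymptotic claim.
\<close>

section \<open>Exponential weights with varying learning rates\<close>

text \<open>
  A convex function on an interval lies below its chord, so the sum is at most the value for a
  two-point distribution with the same mean on the end points; Hoeffding's lemma is then an
  estimate in a single real variable.
\<close>

lemma ln_sum_exp_le:
  fixes p l :: "'a \<Rightarrow> real"
  assumes A: "finite A" and p: "\<And>k. k \<in> A \<Longrightarrow> 0 \<le> p k" and p1: "sum p A = 1"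
    and l: "\<And>k. k \<in> A \<Longrightarrow> l k \<in> {m..m + R}" and R: "0 < R" and \<eta>: "0 \<le> \<eta>"
  shows "ln (\<Sum>k\<in>A. p k * exp (- \<eta> * l k)) \<le> - \<eta> * (\<Sum>k\<in>A. p k * l k) + \<eta>\<^sup>2 * R\<^sup>2 / 8"
proof -
  \<comment> \<open>Position of the loss in its interval: 1 at the best possible loss \<open>m\<close>, 0 at the worst one.\<close>
  define b where "b = m + R"
  define x where "x k = (b - l k) / R" for k
  define P where "P = (\<Sum>k\<in>A. p k * x k)"
  have x: "x k \<in> {0..1}" if "k \<in> A" for k
    using l[OF that] R by (auto simp: x_def b_def divide_simps)
  have l_eq: "l k = b - R * x k" for k
    using R by (simp add: x_def)
  have P0: "0 \<le> P"
    unfolding P_def using p x by (intro sum_nonneg mult_nonneg_nonneg) auto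
  have chord: "exp (- \<eta> * l k) \<le> exp (- \<eta> * b) * (1 + x k * (exp (\<eta> * R) - 1))" if "k \<in> A" for k
  proof -
    have "exp (\<eta> * R * ((1 - x k) *\<^sub>R 0 + x k *\<^sub>R 1))
        \<le> (1 - x k) * exp (\<eta> * R * 0) + x k * exp (\<eta> * R * 1)"
      using x[OF that] \<eta> R by (intro convex_onD[OF convex_on_exp]) auto
    then have "exp (\<eta> * R * x k) \<le> 1 + x k * (exp (\<eta> * R) - 1)"
      by (simp add: algebra_simps)
    moreover have "exp (- \<eta> * l k) = exp (- \<eta> * b) * exp (\<eta> * R * x k)"
      by (simp add: l_eq algebra_simps flip: exp_add)
    ultimately show ?thesis by simp
  qed
  have "(\<Sum>k\<in>A. p k * exp (- \<eta> * l k))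
      \<le> (\<Sum>k\<in>A. p k * (exp (- \<eta> * b) * (1 + x k * (exp (\<eta> * R) - 1))))"
    using p chord by (intro sum_mono mult_left_mono) auto
  also have "\<dots> = exp (- \<eta> * b) * (sum p A + P * (exp (\<eta> * R) - 1))"
    unfolding P_def sum_distrib_right sum.distrib[symmetric] sum_distrib_left
    by (intro sum.cong refl) (simp add: algebra_simps)
  finally have le: "(\<Sum>k\<in>A. p k * exp (- \<eta> * l k))
      \<le> exp (- \<eta> * b) * (1 + P * (exp (\<eta> * R) - 1))" by (simp add: p1)
  obtain k where "k \<in> A" "p k > 0"
    using p p1 by (metis less_eq_real_def sum.neutral zero_neq_one)
  then have pos: "0 < (\<Sum>k\<in>A. p k * exp (- \<eta> * l k))"
    using A p by (intro sum_pos2[of A k]) auto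
  have "0 \<le> \<eta> * R" using \<eta> R by simp
  then have pos': "0 < 1 + P * (exp (\<eta> * R) - 1)"
    using P0 by (intro add_pos_nonneg mult_nonneg_nonneg) auto
  have "ln (\<Sum>k\<in>A. p k * exp (- \<eta> * l k)) \<le> ln (exp (- \<eta> * b) * (1 + P * (exp (\<eta> * R) - 1)))"
    using le pos by simp
  also have "\<dots> = - \<eta> * b + ln (1 + P * (exp (\<eta> * R) - 1))"
    using pos' by (simp add: ln_mult)
  also have "\<dots> \<le> - \<eta> * b + (\<eta> * R * P + (\<eta> * R)\<^sup>2 / 8)"
    using Hoeffdings_lemma_aux[OF \<open>0 \<le> \<eta> * R\<close> P0] by simp
  also have "\<dots> = - \<eta> * (\<Sum>k\<in>A. p k * l k) + \<eta>\<^sup>2 * R\<^sup>2 / 8"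
  proof -
    have "(\<Sum>k\<in>A. p k * l k) = b * sum p A - R * P"
      by (simp add: l_eq P_def sum_distrib_left sum_subtractf algebra_simps)
    then have mean: "(\<Sum>k\<in>A. p k * l k) = b - R * P" by (simp add: p1)
    show ?thesis unfolding mean by (simp add: algebra_simps power2_eq_square)
  qed
  finally show ?thesis .
qed

text \<open>
  Concavity of $x \mapsto x^r$. This comparison absorbs a change of the learning rate: raising
  weights to the power $r$ increases their sum by a factor of at most $K^{1-r}$, for $K$ weights.
\<close>

lemma sum_powr_le:
  fixes w :: "'a \<Rightarrow> real"
  assumes A: "finite A" "A \<noteq> {}" and w: "\<And>k. k \<in> A \<Longrightarrow> 0 < w k" and r: "0 < r" "r \<le> 1"
  shows "(\<Sum>k\<in>A. w k powr r) \<le> real (card A) powr (1 - r) * (sum w A) powr r"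
proof -
  let ?K = "real (card A)"
  have K: "?K > 0" using A by (simp add: card_gt_0_iff)
  have w0: "w k \<noteq> 0" if "k \<in> A" for k using w[OF that] by simp
  have S: "0 < (\<Sum>k\<in>A. w k powr r)" using A w0 by (intro sum_pos) auto
  have "(\<Sum>k\<in>A. (1 / ?K) *\<^sub>R (w k powr r)) powr (1 / r)
      \<le> (\<Sum>k\<in>A. (1 / ?K) * (w k powr r) powr (1 / r))"
    using A r w0 K by (intro convex_on_sum[OF _ _ powr_convex]) auto
  also have "\<dots> = (\<Sum>k\<in>A. (1 / ?K) * w k)"
    using w r by (intro sum.cong refl) (simp add: powr_powr less_imp_le)
  finally have "((\<Sum>k\<in>A. w k powr r) / ?K) powr (1 / r) \<le> sum w A / ?K"
    by (simp add: sum_divide_distrib)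
  then have "(((\<Sum>k\<in>A. w k powr r) / ?K) powr (1 / r)) powr r \<le> (sum w A / ?K) powr r"
    using r by (intro powr_mono2) auto
  then have "(\<Sum>k\<in>A. w k powr r) / ?K \<le> sum w A powr r / ?K powr r"
    using r S K w by (simp add: powr_powr powr_divide sum_nonneg less_imp_le)
  then show ?thesis
    using K by (simp add: powr_diff field_simps)
qed

text \<open>
  The new weights $u_k = (p_k e^{-\eta \ell_k})^r$ with $r = \eta'/\eta$ are powers of those for the
  rate $\eta$. By the power mean inequality $\ln \sum u$ is at most $(1-r) \ln K$ plus
  $r \ln \sum_k p_k e^{-\eta \ell_k}$, and Hoeffding's lemma bounds the latter logarithm. Divided
  by $\eta'$, the first term becomes $(1/\eta' - 1/\eta) \ln K$; writing the potential as
  $\ln(K p_d)/\eta$ instead of $\ln(p_d)/\eta$ absorbs it.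
\<close>

lemma exp_weights_step:
  fixes p l :: "'a \<Rightarrow> real" and \<eta> \<eta>' R :: real
  defines "u \<equiv> \<lambda>k. p k powr (\<eta>' / \<eta>) * exp (- \<eta>' * l k)"
  assumes A: "finite A" and p: "\<And>k. k \<in> A \<Longrightarrow> 0 < p k" and p1: "sum p A = 1"
    and \<eta>: "0 < \<eta>'" "\<eta>' \<le> \<eta>"
    and R: "0 < R" "\<And>j k. j \<in> A \<Longrightarrow> k \<in> A \<Longrightarrow> l j - l k \<le> R"
    and d: "d \<in> A"
  shows "(\<Sum>k\<in>A. p k * l k) - l d
    \<le> \<eta> * R\<^sup>2 / 8 + (ln (real (card A) * (u d / sum u A)) / \<eta>' - ln (real (card A) * p d) / \<eta>)"
proof -
  let ?K = "real (card A)"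
  define r where "r = \<eta>' / \<eta>"
  define m where "m = Min (l ` A)"
  define w where "w k = p k * exp (- \<eta> * l k)" for k
  have r: "0 < r" "r \<le> 1" and r\<eta>: "r * \<eta> = \<eta>'" using \<eta> by (auto simp: r_def)
  have ne: "A \<noteq> {}" using d by auto
  then have K: "?K > 0" using A by (simp add: card_gt_0_iff)
  have "m \<in> l ` A" unfolding m_def using A ne by (intro Min_in) auto
  then have l: "l k \<in> {m..m + R}" if "k \<in> A" for k
    using R(2)[OF that] A that by (auto simp: m_def algebra_simps)
  have w: "0 < w k" if "k \<in> A" for k using p[OF that] by (simp add: w_def)
  have u: "u k = w k powr r" if "k \<in> A" for k
  proof -
    have "exp (- \<eta>' * l k) = exp (- \<eta> * l k) powr r"
      by (simp add: exp_powr_real mult.commute mult.left_commute flip: r\<eta>)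
    then show ?thesis
      using p[OF that] by (simp add: u_def w_def powr_mult r_def less_imp_le)
  qed
  have W: "0 < sum w A" using A ne w by (intro sum_pos) auto
  have "0 < u k" if "k \<in> A" for k using p[OF that] by (simp add: u_def)
  then have U: "0 < sum u A" using A ne by (intro sum_pos) auto
  have "sum u A = (\<Sum>k\<in>A. w k powr r)" by (intro sum.cong refl u)
  also have "\<dots> \<le> ?K powr (1 - r) * sum w A powr r"
    using sum_powr_le[OF A ne w r] .
  finally have "ln (sum u A) \<le> ln (?K powr (1 - r) * sum w A powr r)" using U by simp
  also have "\<dots> = (1 - r) * ln ?K + r * ln (sum w A)"
    using K W by (simp add: ln_mult ln_powr)
  also have "r * ln (sum w A) \<le> r * (- \<eta> * (\<Sum>k\<in>A. p k * l k) + \<eta>\<^sup>2 * R\<^sup>2 / 8)"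
    unfolding w_def using A p p1 l R \<eta> r
    by (intro mult_left_mono ln_sum_exp_le[where m = m]) (auto simp: less_imp_le)
  finally have lnU: "ln (sum u A)
      \<le> (1 - r) * ln ?K + r * (- \<eta> * (\<Sum>k\<in>A. p k * l k) + \<eta>\<^sup>2 * R\<^sup>2 / 8)" by simp
  have ud: "ln (u d) = r * ln (p d) - \<eta>' * l d"
    using p[OF d] by (simp add: u_def ln_mult ln_powr r_def)
  have "0 < u d" using p[OF d] by (simp add: u_def)
  then have "ln (?K * (u d / sum u A)) = ln ?K + ln (u d) - ln (sum u A)"
    using K U by (simp add: ln_mult ln_div)
  with lnU ud have "ln (?K * (u d / sum u A))
      \<ge> r * ln ?K + r * ln (p d) - \<eta>' * l d + r * \<eta> * (\<Sum>k\<in>A. p k * l k) - r * (\<eta>\<^sup>2 * R\<^sup>2 / 8)"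
    by (simp add: algebra_simps)
  also have "r * ln ?K + r * ln (p d) = r * ln (?K * p d)"
    using K p[OF d] by (simp add: ln_mult algebra_simps)
  also have "r * (\<eta>\<^sup>2 * R\<^sup>2 / 8) = \<eta>' * (\<eta> * R\<^sup>2 / 8)"
    by (simp add: power2_eq_square flip: r\<eta>)
  finally have "r * ln (?K * p d) + \<eta>' * ((\<Sum>k\<in>A. p k * l k) - l d - \<eta> * R\<^sup>2 / 8)
      \<le> ln (?K * (u d / sum u A))" unfolding r\<eta> by (simp add: algebra_simps)
  then have "(r * ln (?K * p d) + \<eta>' * ((\<Sum>k\<in>A. p k * l k) - l d - \<eta> * R\<^sup>2 / 8)) / \<eta>'
      \<le> ln (?K * (u d / sum u A)) / \<eta>'"
    using \<eta> by (intro divide_right_mono) auto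
  then show ?thesis
    using \<eta> by (simp add: r_def add_divide_distrib)
qed

section \<open>The EG forecaster\<close>

lemma sum_inverse_sqrt_le: "(\<Sum>s<n. 1 / sqrt (real s + 1)) \<le> 2 * sqrt (real n)"
proof (induction n)
  case (Suc n)
  have "1 / sqrt (real n + 1) \<le> 2 * (sqrt (real n + 1) - sqrt (real n))"
  proof -
    have "1 = (sqrt (real n + 1) - sqrt (real n)) * (sqrt (real n + 1) + sqrt (real n))"
      by (simp add: algebra_simps)
    also have "\<dots> \<le> (sqrt (real n + 1) - sqrt (real n)) * (2 * sqrt (real n + 1))"
      by (intro mult_left_mono) auto
    finally show ?thesis by (simp add: divide_le_eq) (simp add: algebra_simps)
  qed
  with Suc show ?case by (simp add: add.commute)
qed simp

text \<open>
  For the experts 0 and 1, with losses 0 and \<open>g s\<close> at step \<open>s\<close>, the weights in closed form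
  (\<open>x s\<close> for the expert 1) obey the recursion of \<open>exp_weights_step\<close>.
\<close>

lemma two_expert_regret:
  fixes g :: "nat \<Rightarrow> real" and \<eta> :: "nat \<Rightarrow> real" and M :: real
  defines "S \<equiv> \<lambda>s. \<Sum>i<s. g i"
  defines "x \<equiv> \<lambda>s. exp (- \<eta> s * S s) / (1 + exp (- \<eta> s * S s))"
  assumes M: "M > 0" and g: "\<And>s. s < n \<Longrightarrow> \<bar>g s\<bar> \<le> M"
    and \<eta>: "\<And>s. 0 < \<eta> s" "\<And>s. \<eta> (Suc s) \<le> \<eta> s"
    and z: "z \<in> {0, 1}"
  shows "(\<Sum>s<n. g s * (x s - z)) \<le> ln 2 / \<eta> n + (\<Sum>s<n. \<eta> s) * (M\<^sup>2 / 8)"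
proof -
  define p where "p s k = (if k = 1 then x s else 1 - x s)" for s and k :: real
  define \<Phi> where "\<Phi> s = ln (2 * p s z) / \<eta> s" for s
  have E: "0 < 1 + exp a" for a :: real by (rule add_pos_pos) auto
  have x: "0 < x s" "x s < 1" for s
    using E by (auto simp: x_def)
  then have p: "0 < p s k" for s k by (simp add: p_def)
  have \<Phi>_0: "\<Phi> 0 = 0" by (simp add: \<Phi>_def p_def x_def S_def)
  have step: "g s * (x s - z) \<le> \<eta> s * (M\<^sup>2 / 8) + (\<Phi> (Suc s) - \<Phi> s)" if "s < n" for s
  proof -
    \<comment> \<open>Up to a common factor the updated weights are \<open>1\<close> and \<open>W\<close>, as prescribed by the closed form.\<close>
    define r where "r = \<eta> (Suc s) / \<eta> s"
    define u where "u k = p s k powr r * exp (- \<eta> (Suc s) * (k * g s))" for k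
    define w where "w = exp (- \<eta> s * S s)"
    have w: "0 < w" by (simp add: w_def)
    have wr: "w powr r = exp (- \<eta> (Suc s) * S s)"
      using \<eta>(1)[of s] by (simp add: w_def exp_powr_real r_def)
    have xs: "x s = w / (1 + w)" by (simp add: x_def w_def)
    then have xs': "1 - x s = 1 / (1 + w)" using w unfolding xs by (simp add: divide_simps)
    define W where "W = exp (- \<eta> (Suc s) * S (Suc s))"
    have W: "w powr r * exp (- \<eta> (Suc s) * g s) = W"
      unfolding wr W_def by (simp add: S_def algebra_simps flip: exp_add)
    have u1: "u 1 = W / (1 + w) powr r"
      using w W by (auto simp: u_def p_def xs powr_divide)
    have u0: "u 0 = 1 / (1 + w) powr r"
      using w by (simp add: u_def p_def xs' powr_divide)
    have pw: "(1 + w) powr r > 0" using w by simp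
    have W0: "0 < W" by (simp add: W_def)
    have u01: "sum u {0, 1} = (1 + W) / (1 + w) powr r"
      by (simp add: u0 u1 add_divide_distrib)
    have xS: "x (Suc s) = W / (1 + W)" by (simp add: x_def W_def)
    have upd: "p (Suc s) k = u k / sum u {0, 1}" if "k \<in> {0, 1}" for k
    proof -
      have "1 - W / (1 + W) = 1 / (1 + W)" using W0 by (simp add: divide_simps)
      moreover have "W / c / ((1 + W) / c) = W / (1 + W)" "1 / c / ((1 + W) / c) = 1 / (1 + W)"
        if "c > 0" for c using that by auto
      ultimately show ?thesis
        using that pw unfolding u01 by (auto simp: p_def xS u0 u1)
    qed
    have "(\<Sum>k\<in>{0, 1}. p s k * (k * g s)) - z * g s
        \<le> \<eta> s * M\<^sup>2 / 8 + (ln (real (card {0, 1 :: real}) * (u z / sum u {0, 1})) / \<eta> (Suc s)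
             - ln (real (card {0, 1 :: real}) * p s z) / \<eta> s)"
      unfolding u_def r_def
      using p M g[OF that] \<eta> z by (intro exp_weights_step) (auto simp: p_def)
    then show ?thesis
      using upd[OF z] by (simp add: p_def \<Phi>_def algebra_simps)
  qed
  have "(\<Sum>s<n. g s * (x s - z)) \<le> (\<Sum>s<n. \<eta> s * (M\<^sup>2 / 8) + (\<Phi> (Suc s) - \<Phi> s))"
    using step by (intro sum_mono) auto
  also have "\<dots> = (\<Sum>s<n. \<eta> s) * (M\<^sup>2 / 8) + \<Phi> n"
    by (simp only: sum.distrib sum_lessThan_telescope sum_distrib_right) (simp add: \<Phi>_0)
  also have "\<Phi> n \<le> ln 2 / \<eta> n"
  proof -
    have "2 * p n z \<le> 2" using x[of n] by (simp add: p_def)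
    then show ?thesis
      unfolding \<Phi>_def using p[of n z] \<eta>(1)[of n] by (intro divide_right_mono) (auto simp: less_imp_le)
  qed
  finally show ?thesis by simp
qed

locale convex_lipschitz_loss =
  fixes M :: real and loss loss' :: "real \<Rightarrow> real \<Rightarrow> real"
  assumes M_pos: "M > 0"
    and loss_range: "\<And>x z. x \<in> {0..1} \<Longrightarrow> z \<in> {0..1} \<Longrightarrow> loss x z \<in> {0..1}"
    and loss_convex: "\<And>z. z \<in> {0..1} \<Longrightarrow> convex_on {0..1} (\<lambda>x. loss x z)"
    and loss_lipschitz: "\<And>z. z \<in> {0..1} \<Longrightarrow> M-lipschitz_on {0..1} (\<lambda>x. loss x z)"
    and loss'_subgradient: "subgradient_fst loss loss'"
begin

lemma loss_diff_le:
  assumes "a \<in> {0..1}" "b \<in> {0..1}" "z \<in> {0..1}"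
  shows "loss a z - loss b z \<le> M * \<bar>a - b\<bar>"
  using lipschitz_onD[OF loss_lipschitz[OF assms(3)] assms(1,2)] by (simp add: dist_real_def)

text \<open>
  The subgradient inequality towards the two ends of the interval, compared with the Lipschitz
  condition. At an end point a subgradient can be arbitrarily large on one side, so it matters that
  the predictions of EG lie strictly between 0 and 1.
\<close>

lemma loss'_bounded:
  assumes x: "0 < x" "x < 1" and z: "z \<in> {0..1}"
  shows "\<bar>loss' x z\<bar> \<le> M"
proof -
  have sub: "loss' x z * (a - x) \<le> M * \<bar>a - x\<bar>" if "a \<in> {0..1}" for a
  proof -
    have "x \<in> {0..1}" using x by simp
    then have "loss a z \<ge> loss x z + loss' x z * (a - x)"
      using loss'_subgradient z that by (auto simp: subgradient_fst_def)
    with loss_diff_le[OF that \<open>x \<in> {0..1}\<close> z] show ?thesis by linarith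
  qed
  have "loss' x z * (1 - x) \<le> M * (1 - x)" using sub[of 1] x by simp
  moreover have "(- loss' x z) * x \<le> M * x" using sub[of 0] x by simp
  ultimately show ?thesis using x by (simp only: mult_le_cancel_right) auto
qed

lemma eg_range: "0 < eg M loss' ys" "eg M loss' ys < 1"
  by (subst eg.simps; simp add: Let_def add_pos_pos)+

text \<open>
  By the subgradient inequality it is enough to bound the linearised regret. It is affine in the
  comparator \<open>z\<close>, so only \<open>z = 0\<close> and \<open>z = 1\<close> matter.
\<close>

lemma eg_regret:
  assumes ys: "set ys \<subseteq> {0..1}" and z: "z \<in> {0..1}"
  shows "(\<Sum>s<length ys. loss (eg M loss' (take s ys)) (ys ! s) - loss z (ys ! s))
    \<le> 3 / 2 * M * sqrt (real (length ys))"
proof (cases "ys = []")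
  case False
  define n where "n = length ys"
  define x where "x s = eg M loss' (take s ys)" for s
  define g where "g s = loss' (x s) (ys ! s)" for s
  define \<eta> where "\<eta> s = inverse M * sqrt (ln 2 / (real s + 1))" for s
  define e where "e s = exp (- \<eta> s * (\<Sum>i<s. g i))" for s
  have n: "n \<ge> 1" using False by (simp add: n_def Suc_le_eq)
  have y: "ys ! s \<in> {0..1}" if "s < n" for s
    using ys that by (auto simp: n_def subset_iff)
  have \<eta>: "0 < \<eta> s" "\<eta> (Suc s) \<le> \<eta> s" for s
    using M_pos by (auto simp: \<eta>_def intro!: divide_left_mono)
  have x_eq: "x s = e s / (1 + e s)" if "s < n" for s
  proof -
    have "(\<Sum>i<s. loss' (eg M loss' (take i (take s ys))) (take s ys ! i)) = (\<Sum>i<s. g i)"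
      by (intro sum.cong) (auto simp: g_def x_def min_def)
    then show ?thesis
      unfolding x_def using that
      by (subst eg.simps) (simp add: Let_def n_def e_def \<eta>_def add.commute min_def)
  qed
  have x: "0 < x s" "x s < 1" for s
    using eg_range by (auto simp: x_def)
  have lin: "loss (x s) (ys ! s) - loss z (ys ! s) \<le> g s * (x s - z)" if "s < n" for s
  proof -
    have "loss z (ys ! s) \<ge> loss (x s) (ys ! s) + g s * (z - x s)"
      using loss'_subgradient x[of s] y[OF that] z by (auto simp: subgradient_fst_def g_def)
    then show ?thesis by (simp add: algebra_simps)
  qed
  define B where "B = ln 2 / \<eta> n + (\<Sum>s<n. \<eta> s) * (M\<^sup>2 / 8)"
  have extreme: "(\<Sum>s<n. g s * (x s - c)) \<le> B" if "c \<in> {0, 1}" for c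
  proof -
    have "(\<Sum>s<n. g s * (x s - c)) = (\<Sum>s<n. g s * (e s / (1 + e s) - c))"
      using x_eq by simp
    also have "\<dots> \<le> B"
      unfolding B_def e_def
    proof (rule two_expert_regret[OF M_pos])
      show "\<bar>g s\<bar> \<le> M" if "s < n" for s
        unfolding g_def using x y[OF that] by (intro loss'_bounded)
    qed (use \<eta> that in auto)
    finally show ?thesis .
  qed
  have "(\<Sum>s<n. g s * (x s - z)) = (1 - z) * (\<Sum>s<n. g s * (x s - 0)) + z * (\<Sum>s<n. g s * (x s - 1))"
    by (simp add: sum_distrib_left algebra_simps flip: sum.distrib)
  also have "\<dots> \<le> (1 - z) * B + z * B"
    using z by (intro add_mono mult_left_mono extreme) auto
  finally have "(\<Sum>s<n. g s * (x s - z)) \<le> B" by (simp add: algebra_simps)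
  moreover have "(\<Sum>s<n. loss (x s) (ys ! s) - loss z (ys ! s)) \<le> (\<Sum>s<n. g s * (x s - z))"
    using lin by (intro sum_mono) auto
  moreover have "B \<le> 3 / 2 * M * sqrt (real n)"
  proof -
    \<comment> \<open>The total is at most $\sqrt{\ln 2}\,(\sqrt{n+1} + \sqrt n/4) M$; the crude bounds
      $\sqrt{\ln 2} \le 5/6$ and $\sqrt{n+1} \le \frac32 \sqrt n$ suffice for the factor 3/2.\<close>
    define c where "c = sqrt (ln 2 :: real)"
    have c: "0 < c" "c * c = ln 2" by (auto simp: c_def)
    have "c \<le> sqrt ((5/6)\<^sup>2)"
      unfolding c_def using ln2_le_25_over_36 by (intro real_sqrt_le_mono) (simp add: power2_eq_square)
    then have c_le: "c \<le> 5 / 6" by simp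
    have "\<eta> n = c / (M * sqrt (real n + 1))"
      by (simp add: \<eta>_def real_sqrt_divide c_def divide_simps)
    then have "ln 2 / \<eta> n = c * M * sqrt (real n + 1)"
      using c(1) M_pos by (simp flip: c(2))
    moreover have "sqrt (real n + 1) \<le> sqrt ((3/2)\<^sup>2 * real n)"
      using n by (intro real_sqrt_le_mono) (simp add: power2_eq_square)
    then have "sqrt (real n + 1) \<le> 3 / 2 * sqrt (real n)"
      by (simp add: real_sqrt_mult)
    ultimately have "ln 2 / \<eta> n \<le> c * M * (3 / 2 * sqrt (real n))"
      using c M_pos by (simp add: mult_left_mono)
    moreover have "(\<Sum>s<n. \<eta> s) * (M\<^sup>2 / 8) = c * M / 8 * (\<Sum>s<n. 1 / sqrt (real s + 1))"
      using M_pos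
      by (simp add: \<eta>_def real_sqrt_divide c_def sum_distrib_left sum_distrib_right power2_eq_square field_simps)
    moreover have "\<dots> \<le> c * M / 8 * (2 * sqrt (real n))"
      using c M_pos by (intro mult_left_mono sum_inverse_sqrt_le) auto
    ultimately have "B \<le> c * (7 / 4 * M * sqrt (real n))"
      by (simp add: B_def algebra_simps)
    also have "\<dots> \<le> 5 / 6 * (7 / 4 * M * sqrt (real n))"
      using c_le M_pos by (intro mult_right_mono) auto
    also have "\<dots> \<le> 3 / 2 * M * sqrt (real n)" using M_pos by simp
    finally show ?thesis .
  qed
  ultimately show ?thesis unfolding x_def n_def by linarith
qed simp

end

section \<open>The meta-algorithm\<close>

text \<open>
  This characterisation replaces all further reasoning about the supremum in the definition.
\<close>

lemma num_active_ge_iff: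
  assumes mono: "strict_mono_on {1..} \<tau>" and d: "1 \<le> d"
  shows "d \<le> num_active \<tau> s \<longleftrightarrow> \<tau> d \<le> s"
proof -
  let ?A = "{d. 1 \<le> d \<and> \<tau> d \<le> s}"
  have ge: "d \<le> \<tau> d + 1" if "1 \<le> d" for d
    using that
  proof (induction d rule: dec_induct)
    case (step n)
    have "\<tau> n < \<tau> (Suc n)" using mono step by (auto simp: strict_mono_on_def)
    with step show ?case by simp
  qed simp
  have fin: "finite ?A"
    by (rule finite_subset[of _ "{..s + 1}"]) (use ge in fastforce)+
  show ?thesis
  proof
    assume le: "d \<le> num_active \<tau> s"
    with d have ne: "?A \<noteq> {}" by (auto simp: num_active_def Sup_nat_def split: if_splits)
    then have "num_active \<tau> s = Max ?A"
      unfolding num_active_def Sup_nat_def by (rule if_not_P)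
    then have "num_active \<tau> s \<in> ?A" using Max_in[OF fin ne] by simp
    moreover have "\<tau> d \<le> \<tau> (num_active \<tau> s)"
      using mono le d by (simp add: strict_mono_on_leD)
    ultimately show "\<tau> d \<le> s" by simp
  next
    assume "\<tau> d \<le> s"
    with d have "d \<in> ?A" by simp
    then show "d \<le> num_active \<tau> s"
      using Max_ge[OF fin] by (auto simp: num_active_def Sup_nat_def)
  qed
qed

lemma num_active_at_start:
  assumes mono: "strict_mono_on {1..} \<tau>" and d: "1 \<le> d"
  shows "num_active \<tau> (\<tau> d) = d"
proof (rule antisym)
  have "\<tau> d < \<tau> (d + 1)" using mono d by (auto simp: strict_mono_on_def)
  then show "num_active \<tau> (\<tau> d) \<le> d"
    using num_active_ge_iff[OF mono, of "d + 1" "\<tau> d"] by simp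
qed (use num_active_ge_iff[OF mono d] in simp)

lemma meta_weight_Suc:
  fixes f :: "nat \<Rightarrow> nat \<Rightarrow> real" and \<eta> :: "nat \<Rightarrow> real"
    and loss :: "real \<Rightarrow> real \<Rightarrow> real" and y :: "int \<Rightarrow> real"
  assumes t: "\<tau> 1 \<le> t" and d: "d \<in> {1..num_active \<tau> t}"
  defines "u \<equiv> \<lambda>k. meta_weight \<tau> \<eta> loss f y t k powr (\<eta> (Suc t) / \<eta> t)
      * exp (- \<eta> (Suc t) * loss (f k t) (y (int t)))"
  shows "meta_weight \<tau> \<eta> loss f y (Suc t) d
    = real (num_active \<tau> t) / real (num_active \<tau> (Suc t)) * (u d / sum u {1..num_active \<tau> t})"
  using t d by (simp add: Let_def u_def)

text \<open>
  The potential of a forecaster in \<open>exp_weights_step\<close> starts at 0 by this lemma.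
\<close>

lemma meta_weight_start:
  fixes f :: "nat \<Rightarrow> nat \<Rightarrow> real"
  assumes mono: "strict_mono_on {1..} \<tau>" and \<tau>1: "1 \<le> \<tau> 1" and d: "1 \<le> d"
  shows "meta_weight \<tau> \<eta> loss f y (\<tau> d) d = 1 / real d"
proof (cases "d = 1")
  case True
  then show ?thesis using \<tau>1 by (cases "\<tau> 1") auto
next
  case False
  define t where "t = \<tau> d - 1"
  have "\<tau> 1 < \<tau> d" and prev: "\<tau> (d - 1) < \<tau> d"
    using mono d False by (auto simp: strict_mono_on_def)
  then have t: "\<tau> d = Suc t" "\<tau> 1 \<le> t" by (auto simp: t_def)
  have "num_active \<tau> t = d - 1"
  proof (rule antisym)
    show "num_active \<tau> t \<le> d - 1"
      using num_active_ge_iff[OF mono d, of t] t by simp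
    show "d - 1 \<le> num_active \<tau> t"
      using num_active_ge_iff[OF mono, of "d - 1" t] d False t prev by simp
  qed
  then show ?thesis
    using t d False num_active_at_start[OF mono d] by (simp add: Let_def)
qed

text \<open>
  A newcomer takes the weight $1/D_{t+1}$ and the others are scaled by $D_t/D_{t+1}$, which keeps
  the total equal to 1.
\<close>

lemma meta_weight_distribution:
  fixes f :: "nat \<Rightarrow> nat \<Rightarrow> real"
  assumes mono: "strict_mono_on {1..} \<tau>" and \<tau>1: "1 \<le> \<tau> 1" and t: "\<tau> 1 \<le> t"
  shows "(\<forall>k\<in>{1..num_active \<tau> t}. 0 < meta_weight \<tau> \<eta> loss f y t k)
    \<and> sum (meta_weight \<tau> \<eta> loss f y t) {1..num_active \<tau> t} = 1"
  using t
proof (induction t rule: nat_induct_at_least)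
  case base
  show ?case
    using num_active_at_start[OF mono order_refl] meta_weight_start[OF mono \<tau>1 order_refl] by simp
next
  case (Suc t)
  let ?p = "meta_weight \<tau> \<eta> loss f y t" and ?p' = "meta_weight \<tau> \<eta> loss f y (Suc t)"
  let ?D = "num_active \<tau> t" and ?D' = "num_active \<tau> (Suc t)"
  define u where "u k = ?p k powr (\<eta> (Suc t) / \<eta> t) * exp (- \<eta> (Suc t) * loss (f k t) (y (int t)))" for k
  have D: "1 \<le> ?D" using num_active_ge_iff[OF mono, of 1 t] Suc by simp
  have D': "?D' = (if \<tau> (?D + 1) = t + 1 then ?D + 1 else ?D)"
    using num_active_Suc[OF mono] Suc by simp
  have u: "0 < u k" if "k \<in> {1..?D}" for k
    using Suc.IH that by (force simp: u_def)
  then have U: "0 < sum u {1..?D}" using D by (intro sum_pos) auto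
  have old: "?p' k = real ?D / real ?D' * (u k / sum u {1..?D})" if "k \<in> {1..?D}" for k
    unfolding u_def using Suc.hyps that by (intro meta_weight_Suc)
  have old_pos: "0 < ?p' k" if "k \<in> {1..?D}" for k
    unfolding old[OF that] using u[OF that] U D D' by (intro mult_pos_pos divide_pos_pos) auto
  have "sum ?p' {1..?D} = (\<Sum>k\<in>{1..?D}. real ?D / real ?D' * (u k / sum u {1..?D}))"
    by (intro sum.cong refl old)
  also have "\<dots> = real ?D / real ?D'"
    using U by (simp flip: sum_distrib_left sum_divide_distrib)
  finally have old_sum: "sum ?p' {1..?D} = real ?D / real ?D'" .
  show ?case
  proof (cases "\<tau> (?D + 1) = t + 1")
    case True
    then have "?D' = Suc ?D" using D' by simp
    moreover have "?p' (Suc ?D) = 1 / real ?D'"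
      using meta_weight_start[OF mono \<tau>1, of "?D + 1"] True D' by simp
    ultimately show ?thesis
      using old_pos old_sum by (auto simp: le_Suc_eq simp del: meta_weight.simps simp flip: add_divide_distrib)
  next
    case False
    then have "?D' = ?D" using D' by simp
    then show ?thesis using old_pos old_sum D by (simp del: meta_weight.simps)
  qed
qed

context convex_lipschitz_loss
begin

text \<open>
  The meta-algorithm predicts a convex combination, so by convexity of the loss it is at most the
  average loss of the forecasters, and \<open>exp_weights_step\<close> telescopes over the rounds in which
  forecaster \<open>d\<close> is present.
\<close>

lemma meta_regret:
  fixes f :: "nat \<Rightarrow> nat \<Rightarrow> real"
  assumes mono: "strict_mono_on {1..} \<tau>" and \<tau>1: "1 \<le> \<tau> 1"
    and f: "\<And>k t. f k t \<in> {0..1}" and y: "\<And>t. y t \<in> {0..1}"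
    and \<eta>: "\<And>t. 1 \<le> t \<Longrightarrow> 0 < \<eta> t" "\<And>t. 1 \<le> t \<Longrightarrow> \<eta> (Suc t) \<le> \<eta> t"
    and d: "1 \<le> d" and T: "\<tau> d \<le> T"
  shows "(\<Sum>t=\<tau> d..T. loss (meta_predict \<tau> \<eta> loss f y t) (y (int t)) - loss (f d t) (y (int t)))
    \<le> ln (real (num_active \<tau> (Suc T))) / \<eta> (Suc T) + M / 8 * (\<Sum>t=\<tau> d..T. \<eta> t)"
proof -
  define p where "p = meta_weight \<tau> \<eta> loss f y"
  define D where "D = num_active \<tau>"
  define l where "l t k = loss (f k t) (y (int t))" for t k
  define \<Phi> where "\<Phi> t = ln (real (D t) * p t d) / \<eta> t" for t
  \<comment> \<open>A range whose square is at most \<open>M\<close>, however small or large \<open>M\<close> is.\<close>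
  define R where "R = min 1 M"
  have R: "0 < R" using M_pos by (simp add: R_def)
  have "R * R \<le> 1 * M" unfolding R_def using M_pos by (intro mult_mono) auto
  then have R2: "R\<^sup>2 \<le> M" by (simp add: power2_eq_square)
  have "\<tau> 1 \<le> \<tau> d" using mono d by (simp add: strict_mono_on_leD)
  have dist: "0 < p t k" "sum (p t) {1..D t} = 1" if "\<tau> d \<le> t" "k \<in> {1..D t}" for t k
    using meta_weight_distribution[OF mono \<tau>1, of t \<eta> loss f y] that \<open>\<tau> 1 \<le> \<tau> d\<close>
    by (auto simp: p_def D_def)
  have dD: "d \<in> {1..D t}" if "\<tau> d \<le> t" for t
    using num_active_ge_iff[OF mono d, of t] d that by (simp add: D_def)
  have step: "loss (meta_predict \<tau> \<eta> loss f y t) (y (int t)) - l t d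
      \<le> M / 8 * \<eta> t + (\<Phi> (Suc t) - \<Phi> t)" if t: "\<tau> d \<le> t" for t
  proof -
    have t1: "\<tau> 1 \<le> t" "1 \<le> t" using t \<open>\<tau> 1 \<le> \<tau> d\<close> \<tau>1 by auto
    define u where "u k = p t k powr (\<eta> (Suc t) / \<eta> t) * exp (- \<eta> (Suc t) * l t k)" for k
    have "meta_predict \<tau> \<eta> loss f y t = (\<Sum>k\<in>{1..D t}. p t k *\<^sub>R f k t)"
      using t1 by (simp add: meta_predict_def p_def D_def)
    then have "loss (meta_predict \<tau> \<eta> loss f y t) (y (int t)) \<le> (\<Sum>k\<in>{1..D t}. p t k * l t k)"
      using convex_on_sum[of "{1..D t}" "{0..1}" "\<lambda>x. loss x (y (int t))" "p t" "\<lambda>k. f k t"]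
        loss_convex[OF y] dist[OF t] dD[OF t] f
      by (auto simp: l_def less_imp_le)
    moreover have "(\<Sum>k\<in>{1..D t}. p t k * l t k) - l t d
      \<le> \<eta> t * R\<^sup>2 / 8 + (ln (real (card {1..D t}) * (u d / sum u {1..D t})) / \<eta> (Suc t)
           - ln (real (card {1..D t}) * p t d) / \<eta> t)"
      unfolding u_def
    proof (rule exp_weights_step)
      show "l t j - l t k \<le> R" for j k
      proof -
        have "l t j - l t k \<le> M * \<bar>f j t - f k t\<bar>"
          unfolding l_def using f y by (intro loss_diff_le)
        also have "\<dots> \<le> M * 1"
          using f[of j t] f[of k t] M_pos by (intro mult_left_mono) auto
        finally show ?thesis
          using loss_range[OF f y, of j t "int t"] loss_range[OF f y, of k t "int t"]
          by (auto simp: R_def l_def)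
      qed
    qed (use dist[OF t] dD[OF t] \<eta> t1 R in auto)
    moreover have "real (D t) * (u d / sum u {1..D t}) = real (D (Suc t)) * p (Suc t) d"
    proof -
      have "p (Suc t) d = real (D t) / real (D (Suc t)) * (u d / sum u {1..D t})"
        unfolding p_def D_def u_def l_def using t1 dD[OF t] by (intro meta_weight_Suc) (auto simp: D_def)
      moreover have "D (Suc t) \<noteq> 0" using dD[of "Suc t"] t by auto
      ultimately show ?thesis by simp
    qed
    moreover have "\<eta> t * R\<^sup>2 / 8 \<le> M / 8 * \<eta> t"
      using R2 \<eta>(1)[OF t1(2)] by (simp add: mult.commute)
    ultimately show ?thesis by (simp add: \<Phi>_def)
  qed
  have "(\<Sum>t=\<tau> d..T. loss (meta_predict \<tau> \<eta> loss f y t) (y (int t)) - l t d)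
      \<le> (\<Sum>t=\<tau> d..T. M / 8 * \<eta> t + (\<Phi> (Suc t) - \<Phi> t))"
    by (intro sum_mono step) simp
  also have "\<dots> = M / 8 * (\<Sum>t=\<tau> d..T. \<eta> t) + (\<Phi> (Suc T) - \<Phi> (\<tau> d))"
    using T by (simp add: sum.distrib sum_distrib_left sum_Suc_diff)
  also have "\<Phi> (\<tau> d) = 0"
    using meta_weight_start[OF mono \<tau>1 d] num_active_at_start[OF mono d] d
    by (simp add: \<Phi>_def p_def D_def)
  also have "\<Phi> (Suc T) \<le> ln (real (D (Suc T))) / \<eta> (Suc T)"
  proof -
    have T': "\<tau> d \<le> Suc T" using T by simp
    note p = dist[OF T' dD[OF T']]
    have "p (Suc T) d \<le> sum (p (Suc T)) {1..D (Suc T)}"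
      using dD[OF T'] dist(1)[OF T'] by (intro member_le_sum) (auto simp: less_imp_le)
    then have "real (D (Suc T)) * p (Suc T) d \<le> real (D (Suc T))"
      using p by (simp add: mult_left_le)
    moreover have "0 < real (D (Suc T)) * p (Suc T) d"
      using p dD[OF T'] by (intro mult_pos_pos) auto
    ultimately show ?thesis
      unfolding \<Phi>_def using \<eta>(1)[of "Suc T"] by (intro divide_right_mono) auto
  qed
  finally show ?thesis by (simp add: l_def D_def)
qed

end

section \<open>Geometry of the regions\<close>

text \<open>
  A cell contains its right end point only if that is 1, so that neighbouring cells are disjoint
  and the whole of the unit interval is covered.
\<close>

definition cell :: "real \<Rightarrow> real \<Rightarrow> real set" where
  "cell a b = (if b < 1 then {a..<b} else {a..b})"

lemma cell_nonempty: "a < b \<Longrightarrow> cell a b \<noteq> {}"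
  by (auto simp: cell_def)

lemma Inf_cell: "a < b \<Longrightarrow> Inf (cell a b) = a" and Sup_cell: "a < b \<Longrightarrow> Sup (cell a b) = b"
  by (auto simp: cell_def)

lemma PiE_restrict_coordinate:
  "c \<in> I \<Longrightarrow> {x \<in> PiE I S. x c \<in> B} = PiE I (S(c := S c \<inter> B))"
  by (auto simp: PiE_iff extensional_def split: if_splits)

declare region.simps(2) [simp del]

text \<open>
  The step from depth \<open>h\<close> to depth \<open>h + 1\<close> halves the side in coordinate \<open>h mod d + 1\<close>, and
  \<open>(h + d - j) div d\<close> counts how often the turn of coordinate \<open>j\<close> has come before depth \<open>h\<close>.
\<close>

lemma region_is_box:
  assumes d: "1 \<le> d"
  obtains lo hi where
    "region d h i = PiE {1..d} (\<lambda>j. cell (lo j) (hi j))"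
    "\<And>j. j \<in> {1..d} \<Longrightarrow> lo j < hi j"
    "\<And>j. j \<in> {1..d} \<Longrightarrow> 0 \<le> lo j \<and> hi j \<le> 1 \<and> hi j - lo j = (1/2) ^ ((h + d - j) div d)"
proof -
  have "\<exists>lo hi. region d h i = PiE {1..d} (\<lambda>j. cell (lo j) (hi j)) \<and>
    (\<forall>j\<in>{1..d}. 0 \<le> lo j \<and> hi j \<le> 1 \<and> hi j - lo j = (1/2) ^ ((h + d - j) div d))"
  proof (induction h arbitrary: i)
    case 0
    have "unit_cube d = PiE {1..d} (\<lambda>j. cell 0 1)" by (simp add: unit_cube_def cell_def)
    then show ?case
      by (intro exI[of _ "\<lambda>_. 0"] exI[of _ "\<lambda>_. 1"]) auto
  next
    case (Suc h)
    define c where "c = h mod d + 1"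
    have c: "c \<in> {1..d}" using d by (auto simp: c_def Suc_le_eq)
    from Suc.IH[of "(i + 1) div 2"] obtain lo hi
      where X: "region d h ((i + 1) div 2) = PiE {1..d} (\<lambda>j. cell (lo j) (hi j))"
        and *: "\<forall>j\<in>{1..d}. 0 \<le> lo j \<and> hi j \<le> 1 \<and> hi j - lo j = (1/2) ^ ((h + d - j) div d)"
      by (elim exE conjE)
    note lohi = bspec[OF *]
    let ?X = "region d h ((i + 1) div 2)"
    have lt: "lo j < hi j" if "j \<in> {1..d}" for j
      using lohi[OF that] zero_less_power[of "1/2 :: real" "(h + d - j) div d"] by linarith
    have "?X \<noteq> {}" unfolding X using lt by (auto simp: PiE_eq_empty_iff cell_nonempty)
    then have proj: "(\<lambda>x. x c) ` ?X = cell (lo c) (hi c)"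
      unfolding X using c by (simp add: image_projection_PiE)
    define mid where "mid = (lo c + hi c) / 2"
    have mid: "lo c < mid" "mid < hi c" using lt[OF c] by (auto simp: mid_def)
    have step: "(Suc h + d - j) div d = (h + d - j) div d + (if j = c then 1 else 0)"
      if j: "j \<in> {1..d}" for j
    proof -
      define k where "k = h div d"
      define r where "r = h mod d"
      have h: "h = k * d + r" "r < d" using d by (auto simp: k_def r_def)
      have dv: "(k * d + s) div d = (if s < d then k else k + 1)" if "s < 2 * d" for s
        using that d by (auto simp: div_nat_eqI)
      have e1: "Suc h + d - j = k * d + (Suc r + d - j)" and e2: "h + d - j = k * d + (r + d - j)"
        using j by (auto simp: h(1))
      have b: "Suc r + d - j < 2 * d" "r + d - j < 2 * d" using h(2) j by auto
      have "c = r + 1" by (simp add: c_def r_def)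
      then show ?thesis
        unfolding e1 e2 dv[OF b(1)] dv[OF b(2)] using h(2) j by auto
    qed
    have half: "(1/2) ^ ((Suc h + d - c) div d) = (hi c - lo c) / 2"
      using step[OF c] lohi[OF c] by simp
    have reg: "region d (Suc h) i =
        (if odd i then {x \<in> ?X. x c \<in> {lo c..<mid}}
         else if hi c < 1 then {x \<in> ?X. x c \<in> {mid..<hi c}} else {x \<in> ?X. x c \<in> {mid..1}})"
      unfolding region.simps Let_def c_def[symmetric] proj Inf_cell[OF lt[OF c]] Sup_cell[OF lt[OF c]]
        mid_def ..
    show ?case
    proof (cases "odd i")
      case True
      have box: "region d (Suc h) i = PiE {1..d} (\<lambda>j. cell (lo j) ((hi(c := mid)) j))"
        unfolding reg if_P[OF True] unfolding X PiE_restrict_coordinate[OF c]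
        using mid lohi[OF c] by (intro PiE_cong) (auto simp: cell_def)
      have sides: "0 \<le> lo j \<and> (hi(c := mid)) j \<le> 1
          \<and> (hi(c := mid)) j - lo j = (1/2) ^ ((Suc h + d - j) div d)" if "j \<in> {1..d}" for j
        using lohi[OF that] lohi[OF c] mid step[OF that] half
        by (cases "j = c") (auto simp: mid_def field_simps)
      show ?thesis by (rule exI, rule exI, rule conjI, rule box, rule ballI, rule sides)
    next
      case False
      have box: "region d (Suc h) i = PiE {1..d} (\<lambda>j. cell ((lo(c := mid)) j) (hi j))"
      proof (cases "hi c < 1")
        case True
        then show ?thesis
          unfolding reg if_not_P[OF False] if_P[OF True] unfolding X PiE_restrict_coordinate[OF c]
          using mid lohi[OF c] by (intro PiE_cong) (auto simp: cell_def)
      next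
        case hi: False
        show ?thesis
          unfolding reg if_not_P[OF False] if_not_P[OF hi] unfolding X PiE_restrict_coordinate[OF c]
          using mid lohi[OF c] hi by (intro PiE_cong) (auto simp: cell_def)
      qed
      have sides: "0 \<le> (lo(c := mid)) j \<and> hi j \<le> 1
          \<and> hi j - (lo(c := mid)) j = (1/2) ^ ((Suc h + d - j) div d)" if "j \<in> {1..d}" for j
        using lohi[OF that] lohi[OF c] mid step[OF that] half
        by (cases "j = c") (auto simp: mid_def field_simps)
      show ?thesis by (rule exI, rule exI, rule conjI, rule box, rule ballI, rule sides)
    qed
  qed
  then obtain lo hi where X: "region d h i = PiE {1..d} (\<lambda>j. cell (lo j) (hi j))"
    and *: "\<forall>j\<in>{1..d}. 0 \<le> lo j \<and> hi j \<le> 1 \<and> hi j - lo j = (1/2) ^ ((h + d - j) div d)"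
    by (elim exE conjE)
  note lohi = bspec[OF *]
  have "lo j < hi j" if "j \<in> {1..d}" for j
    using lohi[OF that] zero_less_power[of "1/2 :: real" "(h + d - j) div d"] by linarith
  then show ?thesis using that[OF X _ lohi] by simp
qed

lemma region_nonempty: "1 \<le> d \<Longrightarrow> region d h i \<noteq> {}"
  by (rule region_is_box[of d h i]) (auto simp: PiE_eq_empty_iff cell_nonempty)

text \<open>
  The supremum of the split coordinate over a half-open box is attained only if it is 1, which
  is the case that the definition of a region treats apart; hence no point is lost.
\<close>

lemma region_children:
  assumes d: "1 \<le> d" and i: "1 \<le> i"
  shows "region d h i = region d (Suc h) (2 * i - 1) \<union> region d (Suc h) (2 * i)"
    and "region d (Suc h) (2 * i - 1) \<inter> region d (Suc h) (2 * i) = {}"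
proof -
  define c where "c = h mod d + 1"
  have c: "c \<in> {1..d}" using d by (auto simp: c_def Suc_le_eq)
  let ?X = "region d h i"
  obtain lo hi where X: "?X = PiE {1..d} (\<lambda>j. cell (lo j) (hi j))"
    and lt: "\<And>j. j \<in> {1..d} \<Longrightarrow> lo j < hi j"
    and lohi: "\<And>j. j \<in> {1..d} \<Longrightarrow> 0 \<le> lo j \<and> hi j \<le> 1 \<and> hi j - lo j = (1/2) ^ ((h + d - j) div d)"
    using region_is_box[OF d] by blast
  have proj: "(\<lambda>x. x c) ` ?X = cell (lo c) (hi c)"
    using region_nonempty[OF d, of h i] c unfolding X by (simp add: image_projection_PiE)
  define mid where "mid = (lo c + hi c) / 2"
  have idx: "(2 * i - 1 + 1) div 2 = i" "(2 * i + 1) div 2 = i" "odd (2 * i - 1)" "even (2 * i)"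
    using i by auto
  have odd: "region d (Suc h) (2 * i - 1) = {x \<in> ?X. x c \<in> {lo c..<mid}}"
    and even: "region d (Suc h) (2 * i) =
      (if hi c < 1 then {x \<in> ?X. x c \<in> {mid..<hi c}} else {x \<in> ?X. x c \<in> {mid..1}})"
    unfolding region.simps Let_def idx c_def[symmetric] proj
      Inf_cell[OF lt[OF c]] Sup_cell[OF lt[OF c]] mid_def
    using idx by simp_all
  have "x c \<in> cell (lo c) (hi c)" if "x \<in> ?X" for x using proj that by blast
  then show "?X = region d (Suc h) (2 * i - 1) \<union> region d (Suc h) (2 * i)"
    unfolding odd even using lohi[OF c] by (fastforce simp: cell_def split: if_splits)
  show "region d (Suc h) (2 * i - 1) \<inter> region d (Suc h) (2 * i) = {}"
    unfolding odd even by auto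
qed

lemma region_subset_unit_cube: "region d h i \<subseteq> unit_cube d"
proof (induction h arbitrary: i)
  case (Suc h)
  have "region d (Suc h) i \<subseteq> region d h ((i + 1) div 2)" by (auto simp: Let_def region.simps(2))
  with Suc show ?case by blast
qed simp

lemma eucl_dist_region_le:
  assumes d: "1 \<le> d" and x: "x \<in> region d h i" "x' \<in> region d h i"
  shows "eucl_dist d x x' \<le> sqrt (real d) * (1/2) ^ (h div d)"
proof -
  obtain lo hi where X: "region d h i = PiE {1..d} (\<lambda>j. cell (lo j) (hi j))"
    and lt: "\<And>j. j \<in> {1..d} \<Longrightarrow> lo j < hi j"
    and lohi: "\<And>j. j \<in> {1..d} \<Longrightarrow> 0 \<le> lo j \<and> hi j \<le> 1 \<and> hi j - lo j = (1/2) ^ ((h + d - j) div d)"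
    using region_is_box[OF d] by blast
  let ?w = "(1/2 :: real) ^ (h div d)"
  have "(x j - x' j)\<^sup>2 \<le> ?w\<^sup>2" if j: "j \<in> {1..d}" for j
  proof -
    have "x j \<in> cell (lo j) (hi j)" "x' j \<in> cell (lo j) (hi j)"
      using x j unfolding X by (auto simp: PiE_iff)
    then have "\<bar>x j - x' j\<bar> \<le> hi j - lo j" by (auto simp: cell_def split: if_splits)
    also have "\<dots> = (1/2) ^ ((h + d - j) div d)" using lohi[OF j] by simp
    also have "\<dots> \<le> ?w"
      using j by (intro power_decreasing div_le_mono) auto
    finally show ?thesis by (intro abs_le_square_iff[THEN iffD1]) simp
  qed
  then have "(\<Sum>j\<in>{1..d}. (x j - x' j)\<^sup>2) \<le> of_nat (card {1..d}) * ?w\<^sup>2"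
    by (intro sum_bounded_above) auto
  then have "eucl_dist d x x' \<le> sqrt (real d * ?w\<^sup>2)"
    by (simp add: eucl_dist_def L2_set_def)
  then show ?thesis by (simp add: real_sqrt_mult)
qed

lemma eucl_dist_le_eucl_diam:
  assumes d: "1 \<le> d" and x: "x \<in> region d h i" "x' \<in> region d h i"
  shows "eucl_dist d x x' \<le> eucl_diam d (region d h i)"
proof -
  have "bdd_above ((\<lambda>(x, x'). eucl_dist d x x') ` (region d h i \<times> region d h i))"
    using eucl_dist_region_le[OF d] by (auto intro!: bdd_aboveI2)
  then show ?thesis
    unfolding eucl_diam_def using x by (force intro: cSUP_upper2)
qed

lemma eucl_diam_region_pos:
  assumes d: "1 \<le> d"
  shows "0 < eucl_diam d (region d h i)"
proof -
  obtain lo hi where X: "region d h i = PiE {1..d} (\<lambda>j. cell (lo j) (hi j))"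
    and lt: "\<And>j. j \<in> {1..d} \<Longrightarrow> lo j < hi j"
    and lohi: "\<And>j. j \<in> {1..d} \<Longrightarrow> 0 \<le> lo j \<and> hi j \<le> 1 \<and> hi j - lo j = (1/2) ^ ((h + d - j) div d)"
    using region_is_box[OF d] by blast
  \<comment> \<open>A corner and the centre of the box are two distinct points of it.\<close>
  define x where "x = restrict lo {1..d}"
  define x' where "x' = restrict (\<lambda>j. (lo j + hi j) / 2) {1..d}"
  have "x \<in> region d h i" "x' \<in> region d h i"
    unfolding X using lt by (auto simp: x_def x'_def cell_def PiE_iff less_imp_le)
  then have "eucl_dist d x x' \<le> eucl_diam d (region d h i)"
    by (intro eucl_dist_le_eucl_diam[OF d])
  moreover have "0 < (x 1 - x' 1)\<^sup>2" using lt[of 1] d by (simp add: x_def x'_def)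
  then have "0 < eucl_dist d x x'"
    unfolding eucl_dist_def L2_set_def using d by (intro real_sqrt_gt_zero sum_pos2[of _ 1]) auto
  ultimately show ?thesis by simp
qed

text \<open>
  Each side has length at most $2^{-\lfloor h/d \rfloor}$, and $\lfloor h/d \rfloor \ge h/d - 1$;
  the rounding costs the factor 4.
\<close>

lemma eucl_diam_region_le:
  assumes d: "1 \<le> d"
  shows "(eucl_diam d (region d h i))\<^sup>2 \<le> 4 * real d / 4 powr (real h / real d)"
proof -
  have "eucl_diam d (region d h i) \<le> sqrt (real d) * (1/2) ^ (h div d)"
    unfolding eucl_diam_def using region_nonempty[OF d] eucl_dist_region_le[OF d] by (intro cSUP_least) auto
  then have "(eucl_diam d (region d h i))\<^sup>2 \<le> (sqrt (real d) * (1/2) ^ (h div d))\<^sup>2"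
    using eucl_diam_region_pos[OF d, of h i] by (intro power_mono) auto
  also have "\<dots> = real d / 4 ^ (h div d)"
    by (simp add: power_mult_distrib power_divide flip: power_mult) (simp add: power_mult mult.commute)
  also have "\<dots> \<le> 4 * real d / 4 powr (real h / real d)"
  proof -
    have "h \<le> d * (h div d + 1)" using dividend_less_div_times[of d h] d by (simp add: mult.commute)
    then have "real h \<le> real (d * (h div d + 1))" by (simp only: of_nat_le_iff)
    then have "real h / real d \<le> real (h div d + 1)"
      using d by (simp add: divide_le_eq algebra_simps)
    then have "4 powr (real h / real d) \<le> 4 powr real (h div d + 1)" by simp
    also have "\<dots> = 4 * 4 ^ (h div d)" by (simp add: powr_realpow flip: of_nat_Suc)
    finally have "real d * 4 powr (real h / real d) \<le> real d * (4 * 4 ^ (h div d))"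
      by (intro mult_left_mono) auto
    then show ?thesis by (simp add: field_simps)
  qed
  finally show ?thesis .
qed

section \<open>The tree of the nested strategy\<close>

lemma mem_children_iff: "v \<in> children (h, i) \<longleftrightarrow> v = (h + 1, 2 * i - 1) \<or> v = (h + 1, 2 * i)"
  by (auto simp: children_def)

lemma finite_children: "finite (children v)" and card_children_le: "card (children v) \<le> 2"
  by (auto simp: children_def card_insert_if split: prod.splits)

lemma children_inject:
  assumes "w \<in> children u" "w \<in> children v" "1 \<le> snd u" "1 \<le> snd v"
  shows "u = v"
  using assms by (cases u; cases v) (auto simp: mem_children_iff)

text \<open>
  The invariant of the run. The strategy itself stores only the observations that were fed to a
  node; \<open>hist\<close> also records the points at which they occurred, which are needed to compare with
  a function of these points. The last two conjuncts are the bookkeeping of the splitting rule: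
  \<open>length (hist v)\<close> stays at most the inverse squared diameter, or the node receives a single
  observation, and an inner node has reached its threshold. As the threshold may already
  be passed at the first observation if the diameter is large, the case of one observation has to
  be kept apart.
\<close>

definition nested_tree :: "nat \<Rightarrow> node set \<Rightarrow> (node \<Rightarrow> ((nat \<Rightarrow> real) \<times> real) list) \<Rightarrow> bool" where
  "nested_tree d \<T> hist \<longleftrightarrow>
     finite \<T> \<and> (\<forall>v\<in>\<T>. 1 \<le> snd v \<and> snd v \<le> 2 ^ fst v) \<and>
     (\<forall>v\<in>\<T>. v \<noteq> (0, 1) \<longrightarrow> (\<exists>u\<in>\<T>. v \<in> children u)) \<and>
     (\<forall>x\<in>unit_cube d. \<exists>!v. v \<in> \<T> \<and> children v \<inter> \<T> = {} \<and> x \<in> region d (fst v) (snd v)) \<and>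
     (\<forall>v. fst ` set (hist v) \<subseteq> region d (fst v) (snd v)) \<and>
     (\<forall>v. v \<notin> \<T> \<longrightarrow> hist v = []) \<and>
     (\<forall>v. length (hist v) \<le> 1
        \<or> real (length (hist v)) \<le> 1 / (eucl_diam d (region d (fst v) (snd v)))\<^sup>2) \<and>
     (\<forall>v\<in>\<T>. if children v \<inter> \<T> = {}
        then hist v = [] \<or> real (length (hist v)) + 1 < 1 / (eucl_diam d (region d (fst v) (snd v)))\<^sup>2
        else 1 \<le> length (hist v)
          \<and> real (length (hist v)) + 1 \<ge> 1 / (eucl_diam d (region d (fst v) (snd v)))\<^sup>2)"

lemma nested_tree_init: "nested_tree d {(0, 1)} (\<lambda>_. [])"
  by (auto simp: nested_tree_def children_def)

lemma nested_tree_leaf: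
  assumes "nested_tree d \<T> hist" and x: "x \<in> unit_cube d"
  defines "v \<equiv> leaf_of d \<T> x"
  shows "v \<in> \<T>" "children v \<inter> \<T> = {}" "x \<in> region d (fst v) (snd v)"
proof -
  have "\<exists>!v. v \<in> \<T> \<and> children v \<inter> \<T> = {} \<and> x \<in> region d (fst v) (snd v)"
    using assms by (simp add: nested_tree_def)
  from theI'[OF this] show "v \<in> \<T>" "children v \<inter> \<T> = {}" "x \<in> region d (fst v) (snd v)"
    by (simp_all add: v_def leaf_of_def)
qed

text \<open>
  Splitting the leaf \<open>v\<close> replaces it by its children among the leaves. A grandchild of \<open>v\<close>
  cannot be present already, since a tree contains the parent of each node but the root.
\<close>

lemma nested_tree_split:
  assumes bounds: "\<forall>v\<in>\<T>. 1 \<le> snd v"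
    and parents: "\<forall>v\<in>\<T>. v \<noteq> (0, 1) \<longrightarrow> (\<exists>u\<in>\<T>. v \<in> children u)"
    and v: "v \<in> \<T>" "children v \<inter> \<T> = {}" and w: "w \<in> \<T> \<union> children v"
  shows "children w \<inter> (\<T> \<union> children v) = {} \<longleftrightarrow>
    w \<in> children v \<or> w \<noteq> v \<and> children w \<inter> \<T> = {}"
proof (cases "w \<in> children v")
  case True
  obtain h i where vhi: "v = (h, i)" by (cases v)
  have i: "1 \<le> i" using bounds v vhi by auto
  have "z \<notin> \<T>" if z: "z \<in> children w" for z
  proof
    assume "z \<in> \<T>"
    moreover have "z \<noteq> (0, 1)" using z by (cases w) (auto simp: mem_children_iff)
    ultimately obtain u where u: "u \<in> \<T>" "z \<in> children u" using parents by blast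
    have "1 \<le> snd w" using True i vhi by (auto simp: mem_children_iff)
    with u z bounds have "u = w" using children_inject by blast
    with u True v show False by auto
  qed
  moreover have "z \<notin> children v" if "z \<in> children w" for z
    using that True vhi by (cases w) (auto simp: mem_children_iff)
  ultimately show ?thesis using True by auto
next
  case False
  with w have wT: "w \<in> \<T>" by simp
  show ?thesis
  proof (cases "w = v")
    case True
    then show ?thesis using False by (cases v) (auto simp: children_def)
  next
    case wv: False
    then have "children w \<inter> children v = {}"
      using children_inject[of _ w v] bounds v wT by auto
    then show ?thesis using False wv by auto
  qed
qed

text \<open>
  If \<open>v\<close> is split, each point of its region passes to exactly one of the two children, which
  start without observations; all other nodes keep their role and their history.
\<close>

lemma nested_tree_step:
  fixes x :: "nat \<Rightarrow> real" and y :: real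
  assumes d: "1 \<le> d" and tree: "nested_tree d \<T> hist" and x: "x \<in> unit_cube d"
  defines "v \<equiv> leaf_of d \<T> x"
  defines "hist' \<equiv> hist(v := hist v @ [(x, y)])"
  defines "\<T>' \<equiv> if real (length (hist' v)) + 1 \<ge> 1 / (eucl_diam d (region d (fst v) (snd v)))\<^sup>2
    then \<T> \<union> children v else \<T>"
  shows "nested_tree d \<T>' hist'"
proof -
  let ?r = "\<lambda>v. region d (fst v) (snd v)"
  let ?D = "\<lambda>v. 1 / (eucl_diam d (?r v))\<^sup>2"
  note v = nested_tree_leaf[OF tree x, folded v_def]
  note t = tree[unfolded nested_tree_def]
  have fin: "finite \<T>" and bounds: "\<forall>v\<in>\<T>. 1 \<le> snd v \<and> snd v \<le> 2 ^ fst v"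
    and parents: "\<forall>v\<in>\<T>. v \<noteq> (0, 1) \<longrightarrow> (\<exists>u\<in>\<T>. v \<in> children u)"
    and uniq: "\<forall>z\<in>unit_cube d. \<exists>!v. v \<in> \<T> \<and> children v \<inter> \<T> = {} \<and> z \<in> ?r v"
    and hist: "\<forall>v. fst ` set (hist v) \<subseteq> ?r v" "\<forall>v. v \<notin> \<T> \<longrightarrow> hist v = []"
      "\<forall>v. length (hist v) \<le> 1 \<or> real (length (hist v)) \<le> ?D v"
    and counts: "\<forall>v\<in>\<T>. if children v \<inter> \<T> = {} then hist v = [] \<or> real (length (hist v)) + 1 < ?D v
        else 1 \<le> length (hist v) \<and> real (length (hist v)) + 1 \<ge> ?D v"
    using t by - (elim conjE, assumption)+
  have len: "\<forall>w. length (hist' w) \<le> 1 \<or> real (length (hist' w)) \<le> ?D w"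
    using hist(3) counts v by (auto simp: hist'_def dest!: bspec[of _ _ v])
  have hist': "\<forall>w. fst ` set (hist' w) \<subseteq> ?r w"
    using hist(1) v by (auto simp: hist'_def)
  show ?thesis
  proof (cases "real (length (hist' v)) + 1 \<ge> ?D v")
    case False
    then have T': "\<T>' = \<T>" by (simp add: \<T>'_def)
    have empty': "\<forall>w. w \<notin> \<T> \<longrightarrow> hist' w = []" using hist v by (auto simp: hist'_def)
    have "if children w \<inter> \<T> = {} then hist' w = [] \<or> real (length (hist' w)) + 1 < ?D w
        else 1 \<le> length (hist' w) \<and> real (length (hist' w)) + 1 \<ge> ?D w" if "w \<in> \<T>" for w
    proof (cases "w = v")
      case True
      then show ?thesis using v False by simp
    next
      case False
      then have "hist' w = hist w" by (simp add: hist'_def)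
      then show ?thesis using bspec[OF counts that] by (simp only:)
    qed
    then have counts': "\<forall>w\<in>\<T>. if children w \<inter> \<T> = {} then hist' w = [] \<or> real (length (hist' w)) + 1 < ?D w
        else 1 \<le> length (hist' w) \<and> real (length (hist' w)) + 1 \<ge> ?D w" by (rule ballI)
    show ?thesis
      unfolding nested_tree_def T' by (intro conjI fin bounds parents uniq hist' empty' len counts')
  next
    case True
    then have T': "\<T>' = \<T> \<union> children v" by (simp add: \<T>'_def)
    obtain h i where vhi: "v = (h, i)" by (cases v)
    have i: "1 \<le> i" "i \<le> 2 ^ h" using bounds v vhi by auto
    have leaf: "children w \<inter> \<T>' = {} \<longleftrightarrow> w \<in> children v \<or> w \<noteq> v \<and> children w \<inter> \<T> = {}"
      if "w \<in> \<T>'" for w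
      unfolding T' using that bounds parents v T' by (intro nested_tree_split) auto
    have mem: "w \<in> \<T>' \<longleftrightarrow> w \<in> \<T> \<or> w \<in> children v" for w by (simp add: T')
    have fin': "finite \<T>'" by (simp add: T' fin finite_children)
    have bounds': "1 \<le> snd w \<and> snd w \<le> 2 ^ fst w" if "w \<in> \<T>'" for w
      using that bounds i vhi unfolding T' by (auto simp: mem_children_iff)
    have parents': "\<exists>u\<in>\<T>'. w \<in> children u" if "w \<in> \<T>'" "w \<noteq> (0, 1)" for w
      using that parents v unfolding T' by blast
    obtain a b where ch: "children v = {a, b}" and cover: "?r v = ?r a \<union> ?r b"
      and disj: "?r a \<inter> ?r b = {}"
    proof (rule that)
      show "children v = {(h + 1, 2 * i - 1), (h + 1, 2 * i)}" by (simp add: vhi children_def)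
    qed (use region_children[OF d i(1), of h] in \<open>simp_all only: vhi fst_conv snd_conv Suc_eq_plus1\<close>)
    have uniq': "\<exists>!w. w \<in> \<T>' \<and> children w \<inter> \<T>' = {} \<and> z \<in> ?r w" if z: "z \<in> unit_cube d" for z
    proof -
      obtain u where u: "u \<in> \<T> \<and> children u \<inter> \<T> = {} \<and> z \<in> ?r u"
        and *: "\<forall>w. w \<in> \<T> \<and> children w \<inter> \<T> = {} \<and> z \<in> ?r w \<longrightarrow> w = u"
        using bspec[OF uniq z] by (rule ex1E)
      note u_uniq = *[rule_format]
      have L: "w \<in> \<T>' \<and> children w \<inter> \<T>' = {} \<and> z \<in> ?r w
          \<longleftrightarrow> w \<in> children v \<and> z \<in> ?r w \<or> w \<in> \<T> \<and> w \<noteq> v \<and> children w \<inter> \<T> = {} \<and> z \<in> ?r w" for w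
        using leaf[of w] mem[of w] by argo
      have child: "w \<in> children v \<Longrightarrow> z \<in> ?r w \<Longrightarrow> z \<in> ?r v" for w
        unfolding ch cover by blast
      show ?thesis
      proof (cases "u = v")
        case True
        with u have "z \<in> ?r v" by (simp only:)
        then have "\<exists>w\<in>children v. z \<in> ?r w" unfolding cover ch by simp
        then obtain w where w: "w \<in> children v" "z \<in> ?r w" ..
        show ?thesis
        proof (rule ex1I[of _ w], unfold L)
          show "w' = w" if "w' \<in> children v \<and> z \<in> ?r w' \<or>
              w' \<in> \<T> \<and> w' \<noteq> v \<and> children w' \<inter> \<T> = {} \<and> z \<in> ?r w'" for w'
          proof -
            have "w' \<in> children v" "z \<in> ?r w'" using that u_uniq[of w'] True by auto
            with w disj show ?thesis unfolding ch by blast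
          qed
        qed (use w in simp)
      next
        case False
        then have "z \<notin> ?r v" using u_uniq[of v] v by auto
        then have no: "\<not> (w \<in> children v \<and> z \<in> ?r w)" for w using child[of w] by argo
        show ?thesis
        proof (rule ex1I[of _ u], unfold L)
          show "w' = u" if "w' \<in> children v \<and> z \<in> ?r w' \<or>
              w' \<in> \<T> \<and> w' \<noteq> v \<and> children w' \<inter> \<T> = {} \<and> z \<in> ?r w'" for w'
            using that no[of w'] u_uniq[of w'] by argo
        qed (use u False in argo)
      qed
    qed
    have empty': "hist' w = []" if "w \<notin> \<T>'" for w
    proof -
      have "w \<notin> \<T>" using that mem by blast
      then show ?thesis using v(1) hist(2)[rule_format, of w] by (auto simp: hist'_def)
    qed
    have counts': "if children w \<inter> \<T>' = {} then hist' w = [] \<or> real (length (hist' w)) + 1 < ?D w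
        else 1 \<le> length (hist' w) \<and> real (length (hist' w)) + 1 \<ge> ?D w" if w: "w \<in> \<T>'" for w
    proof -
      consider "w \<in> children v" | "w = v" "w \<notin> children v" | "w \<in> \<T>" "w \<noteq> v" "w \<notin> children v"
        using w mem by blast
      then show ?thesis
      proof cases
        case 1
        then have "w \<notin> \<T>" "w \<noteq> v" using v by auto
        then have "hist' w = []" using hist(2)[rule_format, of w] by (simp add: hist'_def)
        moreover have "children w \<inter> \<T>' = {}" using leaf[OF w] 1 by simp
        ultimately show ?thesis by simp
      next
        case 2
        then have "children w \<inter> \<T>' \<noteq> {}" using leaf[OF w] by simp
        then show ?thesis using 2 True by (simp add: hist'_def)
      next
        case 3
        then have "hist' w = hist w" by (simp add: hist'_def)
        moreover have "children w \<inter> \<T>' = {} \<longleftrightarrow> children w \<inter> \<T> = {}" using leaf[OF w] 3 by simp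
        ultimately show ?thesis using bspec[OF counts 3(1)] by (simp only:)
      qed
    qed
    show ?thesis
      unfolding nested_tree_def
      by (rule conjI[OF fin'] conjI[OF ballI[OF bounds']] conjI[OF ballI[OF impI[OF parents']]]
          conjI[OF ballI[OF uniq']] conjI[OF hist'] conjI[OF allI[OF impI[OF empty']]] conjI[OF len]
          ballI[OF counts'] | assumption)+
  qed
qed

text \<open>
  Cumulative loss of the predictor \<open>P\<close> minus that of \<open>f\<close>; here \<open>P past x\<close> is the prediction at
  \<open>x\<close> after the pairs in \<open>past\<close>. It describes both the whole nested run and the run of the
  EG forecaster of a single node.
\<close>

definition excess ::
  "(real \<Rightarrow> real \<Rightarrow> real) \<Rightarrow> (('x \<times> real) list \<Rightarrow> 'x \<Rightarrow> real) \<Rightarrow> ('x \<Rightarrow> real) \<Rightarrow> ('x \<times> real) list \<Rightarrow> real"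
where
  "excess loss P f ps = (\<Sum>n<length ps. loss (P (take n ps) (fst (ps ! n))) (snd (ps ! n))
     - loss (f (fst (ps ! n))) (snd (ps ! n)))"

lemma excess_Nil [simp]: "excess loss P f [] = 0"
  by (simp add: excess_def)

lemma excess_snoc [simp]:
  "excess loss P f (ps @ [(x, y)]) = excess loss P f ps + (loss (P ps x) y - loss (f x) y)"
  by (simp add: excess_def nth_append)

text \<open>
  The rounds are partitioned among the nodes, and within a node the run is that of a single EG
  forecaster. So the regret of the nested strategy is the sum of the regrets of its nodes.
\<close>

lemma nested_eg_run:
  assumes d: "1 \<le> d" and ps: "fst ` set ps \<subseteq> unit_cube d"
  obtains \<T> hist where
    "fold (nested_step d) ps nested_init = (\<T>, \<lambda>v. map snd (hist v))"
    "nested_tree d \<T> hist"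
    "(\<Sum>v\<in>\<T>. length (hist v)) = length ps"
    "\<And>v. set (hist v) \<subseteq> set ps"
    "\<And>loss f. excess loss (nested_eg M loss' d) f ps
       = (\<Sum>v\<in>\<T>. excess loss (\<lambda>hs x. eg M loss' (map snd hs)) f (hist v))"
proof -
  have "\<exists>\<T> hist. fold (nested_step d) ps nested_init = (\<T>, \<lambda>v. map snd (hist v))
    \<and> nested_tree d \<T> hist \<and> (\<Sum>v\<in>\<T>. length (hist v)) = length ps \<and> (\<forall>v. set (hist v) \<subseteq> set ps)
    \<and> (\<forall>loss f. excess loss (nested_eg M loss' d) f ps
       = (\<Sum>v\<in>\<T>. excess loss (\<lambda>hs x. eg M loss' (map snd hs)) f (hist v)))"
    using ps
  proof (induction ps rule: rev_induct)
    case Nil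
    have "fold (nested_step d) [] nested_init = ({(0, 1)}, \<lambda>v. map snd [])"
      by (simp add: nested_init_def)
    then show ?case
      using nested_tree_init by (intro exI[of _ "{(0, 1)}"] exI[of _ "\<lambda>_. []"]) simp
  next
    case (snoc q ps)
    obtain x y where q: "q = (x, y)" by (cases q)
    have x: "x \<in> unit_cube d" using snoc.prems q by simp
    have "fst ` set ps \<subseteq> unit_cube d" using snoc.prems by simp
    from snoc.IH[OF this] obtain \<T> hist
      where run: "fold (nested_step d) ps nested_init = (\<T>, \<lambda>v. map snd (hist v))"
      and tree: "nested_tree d \<T> hist" and len: "(\<Sum>v\<in>\<T>. length (hist v)) = length ps"
      and sub: "\<forall>v. set (hist v) \<subseteq> set ps"
      and exc: "\<forall>loss f. excess loss (nested_eg M loss' d) f ps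
       = (\<Sum>v\<in>\<T>. excess loss (\<lambda>hs x. eg M loss' (map snd hs)) f (hist v))"
      by (elim exE conjE)
    define v where "v = leaf_of d \<T> x"
    define hist' where "hist' = hist(v := hist v @ [(x, y)])"
    define \<T>' where "\<T>' = (if real (length (hist' v)) + 1 \<ge> 1 / (eucl_diam d (region d (fst v) (snd v)))\<^sup>2
      then \<T> \<union> children v else \<T>)"
    have tree': "nested_tree d \<T>' hist'"
      unfolding \<T>'_def hist'_def v_def by (rule nested_tree_step[OF d tree x])
    have vT: "v \<in> \<T>" using nested_tree_leaf[OF tree x] by (simp add: v_def)
    have fin: "finite \<T>'" "finite \<T>" and out: "\<forall>w. w \<notin> \<T> \<longrightarrow> hist w = []"
      using tree tree' unfolding nested_tree_def by - (elim conjE, assumption)+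
    have obs': "(\<lambda>w. map snd (hist w))(v := map snd (hist v) @ [y]) = (\<lambda>w. map snd (hist' w))"
      by (auto simp: hist'_def)
    have "nested_step d (x, y) (\<T>, \<lambda>w. map snd (hist w)) = (\<T>', \<lambda>w. map snd (hist' w))"
      unfolding nested_step_def prod.case Let_def v_def[symmetric] obs' by (simp add: \<T>'_def)
    then have run': "fold (nested_step d) (ps @ [q]) nested_init = (\<T>', \<lambda>w. map snd (hist' w))"
      by (simp add: run q)
    \<comment> \<open>Children start with an empty history, so only the summand of \<open>v\<close> changes.\<close>
    have sum': "(\<Sum>w\<in>\<T>'. \<phi> (hist' w)) = (\<Sum>w\<in>\<T>. \<phi> (hist w)) + (\<phi> (hist v @ [(x, y)]) - \<phi> (hist v))"
      if "\<phi> [] = 0" for \<phi> :: "((nat \<Rightarrow> real) \<times> real) list \<Rightarrow> real"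
    proof -
      have "(\<Sum>w\<in>\<T>'. \<phi> (hist' w)) = (\<Sum>w\<in>\<T>. \<phi> (hist' w))"
        using fin out vT that by (intro sum.mono_neutral_right) (auto simp: \<T>'_def hist'_def)
      also have "\<dots> = \<phi> (hist' v) + (\<Sum>w\<in>\<T> - {v}. \<phi> (hist' w))"
        using fin vT by (intro sum.remove)
      also have "(\<Sum>w\<in>\<T> - {v}. \<phi> (hist' w)) = (\<Sum>w\<in>\<T> - {v}. \<phi> (hist w))"
        by (intro sum.cong) (auto simp: hist'_def)
      also have "\<dots> = (\<Sum>w\<in>\<T>. \<phi> (hist w)) - \<phi> (hist v)"
        using fin vT by (simp add: sum_diff1)
      finally show ?thesis by (simp add: hist'_def)
    qed
    have "real (\<Sum>w\<in>\<T>'. length (hist' w)) = real (length (ps @ [q]))"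
      using sum'[of "\<lambda>hs. real (length hs)"] arg_cong[OF len, of real] by simp
    then have len': "(\<Sum>w\<in>\<T>'. length (hist' w)) = length (ps @ [q])"
      by (simp only: of_nat_eq_iff)
    have sub': "\<forall>w. set (hist' w) \<subseteq> set (ps @ [q])"
      using sub by (auto simp: hist'_def q)
    have "nested_eg M loss' d ps x = eg M loss' (map snd (hist v))"
      by (simp add: nested_eg_def run v_def)
    then have exc': "excess loss (nested_eg M loss' d) f (ps @ [q])
       = (\<Sum>w\<in>\<T>'. excess loss (\<lambda>hs x. eg M loss' (map snd hs)) f (hist' w))" for loss f
      using exc sum'[of "excess loss (\<lambda>hs x. eg M loss' (map snd hs)) f"] by (simp add: q)
    show ?case using run' tree' len' sub' exc' by blast
  qed
  then show ?thesis using that by blast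
qed

section \<open>Regret of the nested strategy\<close>

text \<open>
  Among the constants, the midrange is the best uniform approximation; it gains the factor 1/2 that
  makes room for the bound on the number of nodes.
\<close>

lemma midrange_approx:
  fixes A :: "real set"
  assumes A: "finite A" "A \<noteq> {}" and \<delta>: "\<And>a b. a \<in> A \<Longrightarrow> b \<in> A \<Longrightarrow> a - b \<le> \<delta>"
    and a: "a \<in> A"
  shows "\<bar>(Max A + Min A) / 2 - a\<bar> \<le> \<delta> / 2"
proof -
  have "\<bar>(x + y) / 2 - a\<bar> \<le> \<delta> / 2" if "x - y \<le> \<delta>" "a \<le> x" "y \<le> a" for x y :: real
    using that by (simp add: abs_le_iff field_simps)
  then show ?thesis
    using \<delta>[OF Max_in[OF A] Min_in[OF A]] Max_ge[OF A(1) a] Min_le[OF A(1) a] by blast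
qed

lemma obtain_power_of_two:
  fixes Q :: real
  assumes "1 \<le> Q"
  obtains H :: nat where "Q \<le> 2 ^ H" "2 ^ H \<le> 2 * Q"
proof -
  define H where "H = (LEAST H. Q \<le> 2 ^ H)"
  obtain k :: nat where "Q < 2 ^ k" using real_arch_pow[of 2 Q] by auto
  then have H: "Q \<le> 2 ^ H" unfolding H_def by (intro LeastI[where P = "\<lambda>H. Q \<le> 2 ^ H" and k = k]) simp
  have "(2 :: real) ^ H \<le> 2 * Q"
  proof (cases H)
    case (Suc k)
    then have "\<not> Q \<le> 2 ^ k" using not_less_Least[of k "\<lambda>H. Q \<le> 2 ^ H"] by (simp add: H_def)
    then show ?thesis using Suc by simp
  qed (use assms in simp)
  with H show ?thesis by (rule that)
qed

text \<open>
  When a node is split, \<open>length (hist v) + 1\<close> is at least the inverse squared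
  diameter; as the length is at least 1, the length itself is at least half of that.
\<close>

lemma nested_tree_inner_node:
  assumes d: "1 \<le> d" and tree: "nested_tree d \<T> hist" and v: "v \<in> \<T>" "children v \<inter> \<T> \<noteq> {}"
  shows "4 powr (real (fst v) / real d) \<le> 8 * real d * real (length (hist v))"
proof -
  let ?X = "region d (fst v) (snd v)"
  have counts: "\<forall>v\<in>\<T>. if children v \<inter> \<T> = {}
      then hist v = [] \<or> real (length (hist v)) + 1 < 1 / (eucl_diam d (region d (fst v) (snd v)))\<^sup>2
      else 1 \<le> length (hist v)
        \<and> real (length (hist v)) + 1 \<ge> 1 / (eucl_diam d (region d (fst v) (snd v)))\<^sup>2"
    using tree unfolding nested_tree_def by (elim conjE)
  have n: "1 \<le> length (hist v)" "real (length (hist v)) + 1 \<ge> 1 / (eucl_diam d ?X)\<^sup>2"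
    using bspec[OF counts v(1), unfolded if_not_P[OF v(2)]] by (rule conjunct1, rule conjunct2)
  have pos: "0 < (eucl_diam d ?X)\<^sup>2" using eucl_diam_region_pos[OF d] by (simp add: less_imp_neq[symmetric])
  have "4 powr (real (fst v) / real d) * (eucl_diam d ?X)\<^sup>2 \<le> 4 * real d"
    using eucl_diam_region_le[OF d, of "fst v" "snd v"] by (simp add: field_simps)
  then have "4 powr (real (fst v) / real d) \<le> 4 * real d * (1 / (eucl_diam d ?X)\<^sup>2)"
    using pos by (simp add: field_simps)
  also have "\<dots> \<le> 4 * real d * (2 * real (length (hist v)))"
    using n by (intro mult_left_mono) auto
  finally show ?thesis by simp
qed

text \<open>
  Every node but the root is a child of an inner node, so it suffices to count inner nodes. Those
  of depth below \<open>H\<close> are few because the tree is binary, the others because each of them has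
  used up many of the \<open>n\<close> observations. With \<open>Q \<le> 2 ^ H \<le> 2 * Q\<close> there are at most \<open>2 * Q\<close> of
  the former and \<open>8/3 * Q\<close> of the latter.
\<close>

lemma card_nested_tree_le:
  assumes d: "1 \<le> d" and tree: "nested_tree d \<T> hist"
    and n: "(\<Sum>v\<in>\<T>. length (hist v)) = n" "1 \<le> n"
  shows "real (card \<T>) \<le> 16 * (3 * real d * real n) powr (real d / (real d + 2))"
proof -
  have fin: "finite \<T>" and bounds: "\<forall>v\<in>\<T>. 1 \<le> snd v \<and> snd v \<le> 2 ^ fst v"
    and parents: "\<forall>v\<in>\<T>. v \<noteq> (0, 1) \<longrightarrow> (\<exists>u\<in>\<T>. v \<in> children u)"
    using tree unfolding nested_tree_def by - (elim conjE, assumption)+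
  define I where "I = {v \<in> \<T>. children v \<inter> \<T> \<noteq> {}}"
  \<comment> \<open>\<open>Q\<close> solves \<open>Q * Q powr (2 / d) = K\<close>, which balances the two counts.\<close>
  define K where "K = 3 * real d * real n"
  define Q where "Q = K powr (real d / (real d + 2))"
  have "1 * 1 \<le> real d * real n" using d n by (intro mult_mono) auto
  then have K: "1 \<le> K" by (simp add: K_def)
  then have Q: "1 \<le> Q" by (simp add: Q_def ge_one_powr_ge_zero)
  obtain H :: nat where H: "Q \<le> 2 ^ H" "2 ^ H \<le> 2 * Q" using obtain_power_of_two[OF Q] .
  define hi where "hi = {v \<in> I. H \<le> fst v}"
  have fin': "finite I" "finite hi" using fin by (auto simp: I_def hi_def)
  have "\<T> \<subseteq> insert (0, 1) (\<Union>v\<in>I. children v)"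
  proof
    fix v assume v: "v \<in> \<T>"
    show "v \<in> insert (0, 1) (\<Union>v\<in>I. children v)"
    proof (cases "v = (0, 1)")
      case False
      then obtain u where "u \<in> \<T>" "v \<in> children u" using parents v by blast
      with v have "u \<in> I" by (auto simp: I_def)
      with \<open>v \<in> children u\<close> show ?thesis by blast
    qed simp
  qed
  then have "card \<T> \<le> card (insert (0, 1) (\<Union>v\<in>I. children v))"
    using fin' by (intro card_mono) (auto intro: finite_children)
  also have "\<dots> \<le> Suc (card (\<Union>v\<in>I. children v))" by (rule card_insert_le_m1) auto
  also have "card (\<Union>v\<in>I. children v) \<le> (\<Sum>v\<in>I. card (children v))"
    using fin'(1) by (rule card_UN_le)
  also have "\<dots> \<le> (\<Sum>v\<in>I. 2)" by (intro sum_mono card_children_le)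
  finally have card_T: "card \<T> \<le> 1 + 2 * card I" by simp
  have lo: "card (I - hi) \<le> 2 ^ H"
  proof -
    have "I - hi \<subseteq> Sigma {..<H} (\<lambda>h. {1..2 ^ h})"
      using bounds by (auto simp: I_def hi_def)
    then have "card (I - hi) \<le> card (Sigma {..<H} (\<lambda>h. {1..2 ^ h :: nat}))"
      by (intro card_mono) auto
    also have "\<dots> = 2 ^ H - 1" by (simp add: card_SigmaI sum_power2 lessThan_atLeast0)
    finally show ?thesis by simp
  qed
  have "real (card hi) * Q powr (2 / real d) \<le> 8 / 3 * K"
  proof -
    have "real (card hi) * Q powr (2 / real d) = (\<Sum>v\<in>hi. Q powr (2 / real d))" by simp
    also have "\<dots> \<le> (\<Sum>v\<in>hi. 8 * real d * real (length (hist v)))"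
    proof (rule sum_mono)
      fix v assume v: "v \<in> hi"
      have "Q powr (2 / real d) \<le> (2 ^ H) powr (2 / real d)"
        using H Q by (intro powr_mono2) auto
      also have "\<dots> = 4 powr (real H / real d)"
      proof -
        have "(2 ^ H) powr (2 / real d) = 2 powr (real H * (2 / real d))"
          by (simp add: powr_powr flip: powr_realpow)
        also have "\<dots> = (2 powr 2) powr (real H / real d)"
          unfolding powr_powr by (simp add: mult.commute)
        finally show ?thesis by simp
      qed
      also have "\<dots> \<le> 4 powr (real (fst v) / real d)"
        using v by (intro powr_mono divide_right_mono) (auto simp: hi_def)
      also have "\<dots> \<le> 8 * real d * real (length (hist v))"
        using v by (intro nested_tree_inner_node[OF d tree]) (auto simp: hi_def I_def)
      finally show "Q powr (2 / real d) \<le> 8 * real d * real (length (hist v))" .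
    qed
    also have "\<dots> \<le> (\<Sum>v\<in>\<T>. 8 * real d * real (length (hist v)))"
      using fin by (intro sum_mono2) (auto simp: hi_def I_def)
    also have "\<dots> = 8 / 3 * K"
      using n(1) by (simp add: K_def flip: sum_distrib_left of_nat_sum)
    finally show ?thesis .
  qed
  also have "K = Q * Q powr (2 / real d)"
  proof -
    have e: "1 + 2 / real d = (real d + 2) / real d" using d by (simp add: field_simps)
    have "Q * Q powr (2 / real d) = Q powr (1 + 2 / real d)" using Q by (simp add: powr_add)
    also have "\<dots> = K powr 1" unfolding Q_def e powr_powr using d by simp
    finally show ?thesis using K by simp
  qed
  finally have "real (card hi) * Q powr (2 / real d) \<le> (8 / 3 * Q) * Q powr (2 / real d)" by simp
  then have hi: "real (card hi) \<le> 8 / 3 * Q" using Q by (subst (asm) mult_le_cancel_right) auto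
  have "card I = card hi + card (I - hi)"
    using fin' by (metis card_Diff_subset card_mono hi_def le_add_diff_inverse mem_Collect_eq subsetI)
  then have "real (card \<T>) \<le> 1 + 2 * (real (card hi) + real (card (I - hi)))"
    using of_nat_mono[OF card_T, where 'a = real] by simp
  also have "\<dots> \<le> 1 + 2 * (real (card hi) + 2 ^ H)"
    using of_nat_mono[OF lo, where 'a = real] by simp
  also have "\<dots> \<le> 16 * Q"  using hi H Q by simp
  finally show ?thesis by (simp add: Q_def K_def)
qed

context convex_lipschitz_loss
begin

text \<open>
  The comparison with a constant \<open>z\<close> costs EG's regret, and replacing \<open>z\<close> by the Lipschitz
  function costs, per round, at most \<open>M\<close> times half of its oscillation on the visited points. A single visited point
  has no oscillation, which covers the nodes with a large region.
\<close>

lemma node_regret: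
  assumes d: "1 \<le> d" and f: "f \<in> lipschitz_class L d" and L: "0 < L"
    and x: "fst ` set hs \<subseteq> region d h i" and y: "snd ` set hs \<subseteq> {0..1}"
    and n: "length hs \<le> 1 \<or> real (length hs) \<le> 1 / (eucl_diam d (region d h i))\<^sup>2"
  shows "excess loss (\<lambda>hs x. eg M loss' (map snd hs)) f hs \<le> M * (3 + L) / 2 * sqrt (real (length hs))"
proof (cases "hs = []")
  case False
  define n where "n = length hs"
  define X where "X s = fst (hs ! s)" for s
  define Y where "Y s = snd (hs ! s)" for s
  let ?reg = "region d h i"
  have n1: "1 \<le> n" using False by (simp add: n_def Suc_le_eq)
  have X: "X s \<in> ?reg" and Y: "Y s \<in> {0..1}" if "s < n" for s
    using x y nth_mem[of s hs] that unfolding X_def Y_def n_def by blast+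
  have cube: "?reg \<subseteq> unit_cube d" by (rule region_subset_unit_cube)
  have f01: "f u \<in> {0..1}" if "u \<in> unit_cube d" for u
    using f that by (auto simp: lipschitz_class_def PiE_iff)
  define A where "A = (\<lambda>s. f (X s)) ` {..<n}"
  have fX: "f (X s) \<in> {0..1}" if "s < n" for s
    using f01 X[OF that] cube by blast
  then have A: "finite A" "A \<noteq> {}" "A \<subseteq> {0..1}"
    using n1 by (auto simp: A_def lessThan_empty_iff)
  have \<delta>: "a - b \<le> L / sqrt (real n)" if ab: "a \<in> A" "b \<in> A" for a b
  proof (cases "n = 1")
    case True
    then have "a = b" using ab by (auto simp: A_def)
    then show ?thesis using L by simp
  next
    case False
    obtain s where s: "s < n" "a = f (X s)" using ab(1) unfolding A_def by blast
    obtain t where t: "t < n" "b = f (X t)" using ab(2) unfolding A_def by blast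
    note st = s(1) t(1) s(2) t(2)
    have "a - b \<le> L * eucl_dist d (X s) (X t)"
      using f X[OF st(1)] X[OF st(2)] cube unfolding st lipschitz_class_def
      by (auto simp: abs_le_iff subset_iff)
    also have "\<dots> \<le> L * eucl_diam d ?reg"
      using L X st by (intro mult_left_mono eucl_dist_le_eucl_diam[OF d]) auto
    also have "eucl_diam d ?reg \<le> 1 / sqrt (real n)"
    proof (rule power2_le_imp_le)
      have "real n \<le> 1 / (eucl_diam d ?reg)\<^sup>2" using n False n1 by (auto simp: n_def)
      moreover have "0 < (eucl_diam d ?reg)\<^sup>2"
        using eucl_diam_region_pos[OF d, of h i] by simp
      ultimately show "(eucl_diam d ?reg)\<^sup>2 \<le> (1 / sqrt (real n))\<^sup>2"
        using n1 by (simp add: power_divide field_simps)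
    qed simp
    finally show ?thesis using L by simp
  qed
  define z where "z = (Max A + Min A) / 2"
  have "Max A \<in> {0..1}" "Min A \<in> {0..1}"
    using subsetD[OF A(3) Max_in[OF A(1,2)]] subsetD[OF A(3) Min_in[OF A(1,2)]] by blast+
  then have z: "z \<in> {0..1}" by (simp add: z_def)
  have approx: "loss z (Y s) - loss (f (X s)) (Y s) \<le> M * L / (2 * sqrt (real n))" if s: "s < n" for s
  proof -
    have "loss z (Y s) - loss (f (X s)) (Y s) \<le> M * \<bar>z - f (X s)\<bar>"
      using z Y[OF s] fX[OF s] by (intro loss_diff_le)
    also have "\<dots> \<le> M * (L / sqrt (real n) / 2)"
      unfolding z_def using s M_pos by (intro mult_left_mono midrange_approx A \<delta>) (auto simp: A_def)
    finally show ?thesis by (simp add: mult.commute)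
  qed
  have "excess loss (\<lambda>hs x. eg M loss' (map snd hs)) f hs
      = (\<Sum>s<n. loss (eg M loss' (take s (map snd hs))) (map snd hs ! s) - loss z (map snd hs ! s))
        + (\<Sum>s<n. loss z (Y s) - loss (f (X s)) (Y s))"
    unfolding excess_def sum.distrib[symmetric]
    by (intro sum.cong) (auto simp: n_def X_def Y_def take_map)
  also have "(\<Sum>s<n. loss (eg M loss' (take s (map snd hs))) (map snd hs ! s) - loss z (map snd hs ! s))
      \<le> 3 / 2 * M * sqrt (real n)"
    using eg_regret[of "map snd hs" z] y z by (simp add: n_def)
  also have "(\<Sum>s<n. loss z (Y s) - loss (f (X s)) (Y s)) \<le> (\<Sum>s<n. M * L / (2 * sqrt (real n)))"
    using approx by (intro sum_mono) auto
  also have "\<dots> = M * L / 2 * sqrt (real n)"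
    using n1 by (simp add: real_div_sqrt field_simps)
  finally show ?thesis by (simp add: n_def algebra_simps add_divide_distrib)
qed simp

text \<open>
  Cauchy-Schwarz turns the sum of the square roots of the node counts into the square root of the
  number of nodes times the number of rounds.
\<close>

lemma nested_regret:
  assumes d: "1 \<le> d" and f: "f \<in> lipschitz_class L d" and L: "0 < L"
    and ps: "set ps \<subseteq> unit_cube d \<times> {0..1}" and ne: "ps \<noteq> []"
  shows "excess loss (nested_eg M loss' d) f ps
    \<le> M * (3 + L) * (2 * (3 * real d) powr (real d / (2 * (real d + 2)))
        * real (length ps) powr ((real d + 1) / (real d + 2)))"
proof -
  have "fst ` set ps \<subseteq> unit_cube d" using ps by auto
  then obtain \<T> hist
    where "fold (nested_step d) ps nested_init = (\<T>, \<lambda>v. map snd (hist v))"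
    and tree: "nested_tree d \<T> hist" and len: "(\<Sum>v\<in>\<T>. length (hist v)) = length ps"
    and sub: "\<And>v. set (hist v) \<subseteq> set ps"
    and exc: "\<And>loss f. excess loss (nested_eg M loss' d) f ps
       = (\<Sum>v\<in>\<T>. excess loss (\<lambda>hs x. eg M loss' (map snd hs)) f (hist v))"
    by (rule nested_eg_run[OF d, where M = M and loss' = loss']) blast
  have fin: "finite \<T>" and reg: "\<forall>v. fst ` set (hist v) \<subseteq> region d (fst v) (snd v)"
    and small: "\<forall>v. length (hist v) \<le> 1
        \<or> real (length (hist v)) \<le> 1 / (eucl_diam d (region d (fst v) (snd v)))\<^sup>2"
    using tree unfolding nested_tree_def by - (elim conjE, assumption)+
  define n where "n = length ps"
  define Q where "Q = (3 * real d * real n) powr (real d / (real d + 2))"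
  have n: "1 \<le> n" using ne by (simp add: n_def Suc_le_eq)
  have card: "real (card \<T>) \<le> 16 * Q"
    unfolding Q_def using card_nested_tree_le[OF d tree len] n by (simp add: n_def)
  have "(\<Sum>v\<in>\<T>. 1 * sqrt (real (length (hist v))))\<^sup>2
      \<le> (\<Sum>v\<in>\<T>. 1\<^sup>2) * (\<Sum>v\<in>\<T>. (sqrt (real (length (hist v))))\<^sup>2)"
    by (rule Cauchy_Schwarz_ineq_sum)
  also have "\<dots> = real (card \<T>) * real n"
    using len by (simp add: n_def flip: of_nat_sum)
  also have "\<dots> \<le> 16 * Q * real n" using card by (intro mult_right_mono) auto
  finally have "(\<Sum>v\<in>\<T>. sqrt (real (length (hist v)))) \<le> sqrt (16 * Q * real n)"
    by (intro real_le_rsqrt) simp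
  also have "\<dots> = 4 * sqrt (Q * real n)" by (simp add: real_sqrt_mult)
  also have "sqrt (Q * real n) = (3 * real d) powr (real d / (2 * (real d + 2)))
      * real n powr ((real d + 1) / (real d + 2))"
  proof -
    have "sqrt (Q * real n) = (Q * real n) powr (1 / 2)" by (simp add: powr_half_sqrt Q_def)
    also have "\<dots> = (3 * real d) powr (real d / (2 * (real d + 2)))
        * (real n powr (real d / (2 * (real d + 2))) * real n powr (1 / 2))"
      using d n by (simp add: Q_def powr_mult powr_powr mult_ac)
    also have "real n powr (real d / (2 * (real d + 2))) * real n powr (1 / 2)
        = real n powr ((real d + 1) / (real d + 2))"
    proof -
      have "real d + 2 \<noteq> 0" by simp
      then have "real d / (2 * (real d + 2)) + 1 / 2 = (real d + 1) / (real d + 2)"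
        by (simp add: divide_simps) (simp add: algebra_simps)
      then show ?thesis by (simp flip: powr_add)
    qed
    finally show ?thesis .
  qed
  finally have sqrts: "(\<Sum>v\<in>\<T>. sqrt (real (length (hist v))))
      \<le> 4 * ((3 * real d) powr (real d / (2 * (real d + 2))) * real n powr ((real d + 1) / (real d + 2)))" .
  have "excess loss (nested_eg M loss' d) f ps
      = (\<Sum>v\<in>\<T>. excess loss (\<lambda>hs x. eg M loss' (map snd hs)) f (hist v))"
    by (rule exc)
  also have "\<dots> \<le> (\<Sum>v\<in>\<T>. M * (3 + L) / 2 * sqrt (real (length (hist v))))"
  proof (rule sum_mono)
    fix v
    have "set (hist v) \<subseteq> unit_cube d \<times> {0..1}" using sub[of v] ps by blast
    then have y: "snd ` set (hist v) \<subseteq> {0..1}" by auto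
    show "excess loss (\<lambda>hs x. eg M loss' (map snd hs)) f (hist v)
        \<le> M * (3 + L) / 2 * sqrt (real (length (hist v)))"
      by (rule node_regret[OF d f L reg[rule_format] y small[rule_format]])
  qed
  also have "\<dots> = M * (3 + L) / 2 * (\<Sum>v\<in>\<T>. sqrt (real (length (hist v))))"
    by (simp add: sum_distrib_left)
  also have "\<dots> \<le> M * (3 + L) / 2 * (4 * ((3 * real d) powr (real d / (2 * (real d + 2)))
      * real n powr ((real d + 1) / (real d + 2))))"
    using sqrts M_pos L by (intro mult_left_mono) auto
  finally show ?thesis by (simp add: n_def mult_ac)
qed

end

section \<open>The regret bound\<close>

lemma window_in_unit_cube:
  assumes "\<And>t. y t \<in> {0..1}"
  shows "window y d t \<in> unit_cube d"
  using assms by (auto simp: window_def unit_cube_def)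

context convex_lipschitz_loss
begin

lemma forecaster_regret:
  assumes d: "1 \<le> d" and f: "f \<in> lipschitz_class L d" and L: "0 < L"
    and y: "\<And>t. y t \<in> {0..1}" and start: "1 \<le> \<tau> d" and T: "\<tau> d \<le> T"
  shows "(\<Sum>t=\<tau> d..T. loss (forecaster M loss' \<tau> y d t) (y (int t)) - loss (f (window y d t)) (y (int t)))
    \<le> M * (3 + L) * (2 * (3 * real d) powr (real d / (2 * (real d + 2)))
        * real T powr ((real d + 1) / (real d + 2)))"
proof -
  define q where "q s = (window y d s, y (int s))" for s
  define ps where "ps = map q [\<tau> d..<Suc T]"
  have len: "length ps = Suc T - \<tau> d" by (simp add: ps_def del: upt_Suc)
  have nth: "ps ! n = q (\<tau> d + n)" if "n < length ps" for n
    using that by (simp add: ps_def nth_append del: upt_Suc)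
  have take: "take n ps = map q [\<tau> d..<\<tau> d + n]" if "n < length ps" for n
    using that by (simp add: ps_def take_map del: upt_Suc)
  have "(\<Sum>t=\<tau> d..T. loss (forecaster M loss' \<tau> y d t) (y (int t)) - loss (f (window y d t)) (y (int t)))
      = (\<Sum>n<length ps. loss (forecaster M loss' \<tau> y d (\<tau> d + n)) (y (int (\<tau> d + n)))
          - loss (f (window y d (\<tau> d + n))) (y (int (\<tau> d + n))))"
    using T by (intro sum.reindex_bij_witness[of _ "\<lambda>n. \<tau> d + n" "\<lambda>t. t - \<tau> d"]) (auto simp: len)
  also have "\<dots> = excess loss (nested_eg M loss' d) f ps"
    unfolding excess_def
    by (intro sum.cong refl) (simp add: nth take forecaster_def q_def[abs_def])
  also have "\<dots> \<le> M * (3 + L) * (2 * (3 * real d) powr (real d / (2 * (real d + 2)))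
        * real (length ps) powr ((real d + 1) / (real d + 2)))"
  proof (rule nested_regret[OF d f L])
    show "set ps \<subseteq> unit_cube d \<times> {0..1}"
      using window_in_unit_cube[OF y] y by (auto simp: ps_def q_def)
    show "ps \<noteq> []" using T by (simp add: ps_def del: upt_Suc)
  qed
  also have "\<dots> \<le> M * (3 + L) * (2 * (3 * real d) powr (real d / (2 * (real d + 2)))
        * real T powr ((real d + 1) / (real d + 2)))"
    using M_pos L start T by (intro mult_left_mono powr_mono2) (auto simp: len)
  finally show ?thesis .
qed

lemma forecaster_range: "forecaster M loss' \<tau> y d t \<in> {0..1}"
  using eg_range by (auto simp: forecaster_def nested_eg_def less_imp_le split: prod.split)

lemma meta_predict_range:
  assumes mono: "strict_mono_on {1..} \<tau>" and \<tau>1: "1 \<le> \<tau> 1" and f: "\<And>k t. f k t \<in> {0..1}"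
  shows "meta_predict \<tau> \<eta> loss f y t \<in> {0..1}"
proof (cases "t < \<tau> 1")
  case False
  then have t: "\<tau> 1 \<le> t" by simp
  note p = meta_weight_distribution[OF mono \<tau>1 t, of \<eta> loss f y]
  have "(\<Sum>d=1..num_active \<tau> t. meta_weight \<tau> \<eta> loss f y t d *\<^sub>R f d t) \<in> {0..1}"
    using p f by (intro convex_sum) (auto simp: less_imp_le)
  then show ?thesis using False by (simp add: meta_predict_def)
qed (simp add: meta_predict_def)

text \<open>
  The early rounds contribute \<open>\<tau> d\<close>. With $\eta_t = 2/\sqrt t$ the meta-algorithm contributes
  $\frac12 \sqrt{T+1} \ln D_{T+1}$ and at most $\frac12 M \sqrt T$, which are at most
  the terms with $\sqrt{T+1}$ and $\sqrt T$ in the bound; the last term is the regret of the nested strategy.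
\<close>

lemma regret_le:
  assumes L: "L > 0" and mono: "strict_mono_on {1..} \<tau>" and \<tau>1: "\<tau> 1 = 2"
    and y: "\<And>t. y t \<in> {0..1}"
    and yhat: "yhat = meta_predict \<tau> (\<lambda>t. 2 / sqrt (real t)) loss (forecaster M loss' \<tau> y) y"
    and d: "1 \<le> d" and T: "\<tau> d \<le> T"
  shows "regret loss y yhat L d T
    \<le> real (\<tau> d) + sqrt (real T + 1) * ln (real (num_active \<tau> (T + 1)))
      + M * (3 + L) * (sqrt (real T) + 2 * (3 * real d) powr (real d / (2 * (real d + 2)))
          * real T powr ((real d + 1) / (real d + 2)))"
    (is "_ \<le> ?B")
proof -
  let ?F = "forecaster M loss' \<tau> y"
  let ?\<eta> = "\<lambda>t. 2 / sqrt (real t)"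
  let ?N = "2 * (3 * real d) powr (real d / (2 * (real d + 2))) * real T powr ((real d + 1) / (real d + 2))"
  have \<tau>d: "1 \<le> \<tau> d" using strict_mono_on_leD[OF mono, of 1 d] d \<tau>1 by simp
  have yhat01: "yhat t \<in> {0..1}" for t
    unfolding yhat using \<tau>1 by (intro meta_predict_range mono forecaster_range) simp
  have "1 \<le> num_active \<tau> (Suc T)"
    using num_active_ge_iff[OF mono d, of "Suc T"] T d by simp
  then have "0 \<le> ln (real (num_active \<tau> (Suc T)))" by simp
  then have entropy: "ln (real (num_active \<tau> (Suc T))) / ?\<eta> (Suc T)
      \<le> sqrt (real T + 1) * ln (real (num_active \<tau> (T + 1)))"
    by (simp add: add.commute mult.commute)
  have rates: "M / 8 * (\<Sum>t=\<tau> d..T. ?\<eta> t) \<le> M * (3 + L) * sqrt (real T)"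
  proof -
    have "(\<Sum>t=\<tau> d..T. ?\<eta> t) \<le> (\<Sum>t=1..T. ?\<eta> t)"
      using \<tau>d by (intro sum_mono2) auto
    also have "\<dots> = 2 * (\<Sum>s<T. 1 / sqrt (real s + 1))"
      unfolding sum_distrib_left
      by (intro sum.reindex_bij_witness[of _ "Suc" "\<lambda>t. t - 1"]) (auto simp: of_nat_diff)
    also have "\<dots> \<le> 4 * sqrt (real T)" using sum_inverse_sqrt_le[of T] by simp
    finally have "M / 8 * (\<Sum>t=\<tau> d..T. ?\<eta> t) \<le> M / 8 * (4 * sqrt (real T))"
      using M_pos by (intro mult_left_mono) auto
    also have "\<dots> = M * (1 / 2) * sqrt (real T)" by simp
    also have "\<dots> \<le> M * (3 + L) * sqrt (real T)"
      using M_pos L by (intro mult_right_mono mult_left_mono) auto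
    finally show ?thesis .
  qed
  have comparator: "(\<Sum>t=1..T. loss (yhat t) (y (int t))) - ?B
      \<le> (\<Sum>t=1..T. loss (f (window y d t)) (y (int t)))" if f: "f \<in> lipschitz_class L d" for f
  proof -
    define l where "l t = loss (yhat t) (y (int t)) - loss (f (window y d t)) (y (int t))" for t
    have f01: "f (window y d t) \<in> {0..1}" for t
      using f window_in_unit_cube[of y d t, OF y] by (auto simp: lipschitz_class_def PiE_iff)
    have l1: "l t \<le> 1" for t
      using loss_range[OF yhat01 y, of t "int t"] loss_range[OF f01 y, of t "int t"]
      by (simp add: l_def)
    have "{1..T} = {1..<\<tau> d} \<union> {\<tau> d..T}" using T \<tau>d by auto
    then have split: "(\<Sum>t=1..T. l t) = (\<Sum>t\<in>{1..<\<tau> d}. l t)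
        + ((\<Sum>t=\<tau> d..T. loss (yhat t) (y (int t)) - loss (?F d t) (y (int t)))
          + (\<Sum>t=\<tau> d..T. loss (?F d t) (y (int t)) - loss (f (window y d t)) (y (int t))))"
      by (simp add: sum.union_disjoint ivl_disj_int l_def flip: sum.distrib)
    have "(\<Sum>t\<in>{1..<\<tau> d}. l t) \<le> of_nat (card {1..<\<tau> d}) * 1"
      using l1 by (intro sum_bounded_above) auto
    then have early: "(\<Sum>t\<in>{1..<\<tau> d}. l t) \<le> real (\<tau> d)" by simp
    have nested: "(\<Sum>t=\<tau> d..T. loss (?F d t) (y (int t)) - loss (f (window y d t)) (y (int t)))
        \<le> M * (3 + L) * ?N"
      by (rule forecaster_regret[where \<tau> = \<tau> and y = y, OF d f L y \<tau>d T])
    have "(\<Sum>t=\<tau> d..T. loss (yhat t) (y (int t)) - loss (?F d t) (y (int t)))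
        \<le> ln (real (num_active \<tau> (Suc T))) / ?\<eta> (Suc T) + M / 8 * (\<Sum>t=\<tau> d..T. ?\<eta> t)"
      unfolding yhat
    proof (rule meta_regret[where \<tau> = \<tau> and f = ?F and y = y and \<eta> = ?\<eta>,
          OF mono _ forecaster_range y _ _ d T])
      show "2 / sqrt (real (Suc t)) \<le> 2 / sqrt (real t)" if "1 \<le> t" for t
        using that by (intro divide_left_mono) auto
    qed (use \<tau>1 in auto)
    then have meta: "(\<Sum>t=\<tau> d..T. loss (yhat t) (y (int t)) - loss (?F d t) (y (int t)))
        \<le> sqrt (real T + 1) * ln (real (num_active \<tau> (T + 1))) + M * (3 + L) * sqrt (real T)"
      using entropy rates by linarith
    have "(\<Sum>t=1..T. l t) \<le> real (\<tau> d)
        + (sqrt (real T + 1) * ln (real (num_active \<tau> (T + 1))) + M * (3 + L) * sqrt (real T)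
          + M * (3 + L) * ?N)"
      unfolding split by (intro add_mono early meta nested)
    also have "\<dots> = ?B"
      unfolding distrib_left[of "M * (3 + L)"] by (simp only: add.assoc)
    finally have "(\<Sum>t=1..T. l t) \<le> ?B" .
    then show ?thesis by (simp add: l_def sum_subtractf)
  qed
  have "(\<lambda>x\<in>unit_cube d. 0) \<in> lipschitz_class L d"
    using L by (auto simp: lipschitz_class_def eucl_dist_def)
  then have "(\<Sum>t=1..T. loss (yhat t) (y (int t))) - ?B
      \<le> (INF f\<in>lipschitz_class L d. \<Sum>t=1..T. loss (f (window y d t)) (y (int t)))"
    using comparator by (intro cINF_greatest) auto
  then show ?thesis by (simp add: regret_def)
qed

end

lemma num_active_le:
  assumes mono: "strict_mono_on {1..} \<tau>" and \<tau>1: "1 \<le> \<tau> 1"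
  shows "num_active \<tau> s \<le> s"
proof (cases "num_active \<tau> s = 0")
  case False
  have ge: "d \<le> \<tau> d" if "1 \<le> d" for d
    using that
  proof (induction d rule: dec_induct)
    case (step n)
    have "\<tau> n < \<tau> (Suc n)" using mono step by (auto simp: strict_mono_on_def)
    with step show ?case by simp
  qed (use \<tau>1 in simp)
  have "\<tau> (num_active \<tau> s) \<le> s"
    using num_active_ge_iff[OF mono, of "num_active \<tau> s" s] False by simp
  then show ?thesis using ge[of "num_active \<tau> s"] False by simp
qed simp

lemma regret_bound_rate:
  fixes c A B e :: real
  assumes "e < 1"
  shows "(\<lambda>T. (c + sqrt (real T + 1) * ln (real T + 1) + A * (sqrt (real T) + B * real T powr e)) / real T)
    \<longlonglongrightarrow> 0"
proof -
  have 1: "(\<lambda>T. (c + sqrt (real T + 1) * ln (real T + 1)) / real T) \<longlonglongrightarrow> 0"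
    by real_asymp
  have 2: "(\<lambda>T. sqrt (real T) / real T) \<longlonglongrightarrow> 0" by real_asymp
  have "(\<lambda>T. real T powr (e - 1)) \<longlonglongrightarrow> 0" using assms by real_asymp
  then have 3: "(\<lambda>T. real T powr e / real T) \<longlonglongrightarrow> 0"
    by (rule Lim_transform_eventually)
      (auto intro!: eventually_mono[OF eventually_gt_at_top[of 0]] simp: powr_diff)
  have "(\<lambda>T. (c + sqrt (real T + 1) * ln (real T + 1)) / real T
      + A * (sqrt (real T) / real T + B * (real T powr e / real T))) \<longlonglongrightarrow> 0 + A * (0 + B * 0)"
    by (intro tendsto_intros 1 2 3)
  then show ?thesis by (simp add: add_divide_distrib algebra_simps)
qed

theorem theorem2:
  fixes M L :: real
    and loss loss' :: "real \<Rightarrow> real \<Rightarrow> real"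
    and \<tau> :: "nat \<Rightarrow> nat"
    and y :: "int \<Rightarrow> real"
    and yhat :: "nat \<Rightarrow> real"
  assumes "M > 0" and "L > 0"
    and "\<And>x z. x \<in> {0..1} \<Longrightarrow> z \<in> {0..1} \<Longrightarrow> loss x z \<in> {0..1}"
    and "\<And>z. z \<in> {0..1} \<Longrightarrow> convex_on {0..1} (\<lambda>x. loss x z)"
    and "\<And>z. z \<in> {0..1} \<Longrightarrow> M-lipschitz_on {0..1} (\<lambda>x. loss x z)"
    and "subgradient_fst loss loss'"
    and "strict_mono_on {1..} \<tau>" and "\<tau> 1 = 2"
    and "\<And>t. y t \<in> {0..1}"
    and "yhat = meta_predict \<tau> (\<lambda>t. 2 / sqrt (real t)) loss (forecaster M loss' \<tau> y) y"
  shows "(\<forall>T\<ge>1. \<forall>d\<ge>1. d \<le> num_active \<tau> T \<longrightarrow>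
            regret loss y yhat L d T
              \<le> real (\<tau> d) + sqrt (real T + 1) * ln (real (num_active \<tau> (T + 1)))
                + M * (3 + L) * (sqrt (real T)
                    + 2 * (3 * real d) powr (real d / (2 * (real d + 2)))
                        * real T powr ((real d + 1) / (real d + 2))))
       \<and> (\<forall>d\<ge>1. limsup (\<lambda>T. ereal (regret loss y yhat L d T / real T)) \<le> 0)"
proof -
  interpret convex_lipschitz_loss M loss loss'
    using assms(1,3-6) by unfold_locales auto
  note bound = regret_le[OF assms(2,7-10)]
  have "limsup (\<lambda>T. ereal (regret loss y yhat L d T / real T)) \<le> 0" if d: "1 \<le> d" for d
  proof -
    define A where "A = M * (3 + L)"
    define B where "B = 2 * (3 * real d) powr (real d / (2 * (real d + 2)))"
    define g where "g T = (real (\<tau> d) + sqrt (real T + 1) * ln (real T + 1)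
      + A * (sqrt (real T) + B * real T powr ((real d + 1) / (real d + 2)))) / real T" for T :: nat
    have "(real d + 1) / (real d + 2) < 1" by simp
    then have "g \<longlonglongrightarrow> 0" unfolding g_def by (rule regret_bound_rate)
    then have "(\<lambda>T. ereal (g T)) \<longlonglongrightarrow> ereal 0" by (rule tendsto_ereal)
    then have lim: "limsup (\<lambda>T. ereal (g T)) = 0"
      using lim_imp_Limsup[of sequentially "\<lambda>T. ereal (g T)"] by (simp add: zero_ereal_def)
    have "regret loss y yhat L d T / real T \<le> g T" if T: "\<tau> d \<le> T" for T
    proof -
      have pos: "1 \<le> num_active \<tau> (T + 1)"
        using num_active_ge_iff[OF assms(7) d, of "T + 1"] T d by simp
      have "num_active \<tau> (T + 1) \<le> T + 1"
        using assms(8) by (intro num_active_le[OF assms(7)]) simp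
      then have "real (num_active \<tau> (T + 1)) \<le> real T + 1"
        by (metis of_nat_1 of_nat_add of_nat_le_iff)
      then have "ln (real (num_active \<tau> (T + 1))) \<le> ln (real T + 1)" using pos by simp
      then have "sqrt (real T + 1) * ln (real (num_active \<tau> (T + 1))) \<le> sqrt (real T + 1) * ln (real T + 1)"
        by (intro mult_left_mono) auto
      with bound[OF d T] have "regret loss y yhat L d T \<le> real (\<tau> d) + sqrt (real T + 1) * ln (real T + 1)
          + A * (sqrt (real T) + B * real T powr ((real d + 1) / (real d + 2)))"
        unfolding A_def B_def by linarith
      then show ?thesis unfolding g_def by (intro divide_right_mono) auto
    qed
    then have "\<forall>\<^sub>F T in sequentially. ereal (regret loss y yhat L d T / real T) \<le> ereal (g T)"
      by (intro eventually_sequentiallyI[of "\<tau> d"]) simp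
    then have "limsup (\<lambda>T. ereal (regret loss y yhat L d T / real T)) \<le> limsup (\<lambda>T. ereal (g T))"
      by (rule Limsup_mono)
    with lim show ?thesis by simp
  qed
  moreover have started: "\<tau> d \<le> T" if "1 \<le> d" "d \<le> num_active \<tau> T" for d T
    using num_active_ge_iff[OF assms(7) that(1)] that(2) by blast
  ultimately show ?thesis using bound by (intro conjI allI impI) auto
qed

end
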